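(* Let $p(D)$ be a Fourier multiplier of order $m\in\mathbb{R}$ on $\mathbb{T}^n$, with symbol $p:\mathbb{Z}^n\to\mathbb{C}$, and let $r\ge 0$. The following conditions are equivalent: (1) The symbol $p(\xi)$ vanishes for at most finitely many $\xi\in\mathbb{Z}^n$, and there exists a constant $C>0$ such that $|p(\xi)|\ge C|\xi|^{m-r}$ for every $\xi\in\mathbb{Z}^n\setminus\{0\}$ such that $p(\xi)\ne 0$. (2) For every $k\in\mathbb{R}$, the following implication holds: if $u\in\mathscr{D}'(\mathbb{T}^n)$ and $p(D)u\in H^k(\mathbb{T}^n)$, then $u\in H^{k+m-r}(\mathbb{T}^n)$. Moreover, $p(D)$ is globally hypoelliptic in the classical sense if and only if either of the equivalent conditions above holds for some $r\ge 0$.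
   Context: $\mathbb{T}^n$ is the $n$-dimensional torus $(\mathbb{R}/2\pi\mathbb{Z})^n$, $\mathscr{D}'(\mathbb{T}^n)$ its space of distributions, and $\widehat{u}(\xi)$, $\xi\in\mathbb{Z}^n$, are the Fourier coefficients of $u$, so $u=\sum_\xi \widehat{u}(\xi)e^{ix\cdot\xi}$. For $\xi\in\mathbb{Z}^n$, $|\xi|=\sum_j|\xi_j|$ and $\|\xi\|=(\sum_j|\xi_j|^2)^{1/2}$. For $k\in\mathbb{R}$, $H^k(\mathbb{T}^n)$ is the set of $u\in\mathscr{D}'(\mathbb{T}^n)$ with $\sum_{\xi\in\mathbb{Z}^n}(1+\|\xi\|^2)^k|\widehat{u}(\xi)|^2<\infty$. A function $p:\mathbb{Z}^n\to\mathbb{C}$ is a symbol of order $m\in\mathbb{R}$ if there is a constant $C>0$ with $|p(\xi)|\le C(1+\|\xi\|^2)^{m/2}$ for all $\xi\in\mathbb{Z}^n$; the Fourier multiplier of order $m$ with symbol $p$ is the operator $p(D):\mathscr{D}'(\mathbb{T}^n)\to\mathscr{D}'(\mathbb{T}^n)$ with $\widehat{p(D)u}(\xi)=p(\xi)\widehat{u}(\xi)$. The operator $p(D)$ is globally hypoelliptic (in the classical sense) if $u\in\mathscr{D}'(\mathbb{T}^n)$ and $p(D)u\in C^\infty(\mathbb{T}^n)$ imply $u\in C^\infty(\mathbb{T}^n)$. *)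

theory Defs
  imports "HOL-Analysis.Analysis" "HOL-Library.FuncSet"
begin

text \<open>
  The torus \<open>(\<real>/2\<pi>\<int>)\<^sup>n\<close> is rendered through functions on \<open>real ^ 'n\<close>, \<open>n = CARD('n)\<close>, that are
  \<open>2\<pi>\<close>-periodic in each coordinate; frequencies are elements of \<open>int ^ 'n\<close>.
\<close>

definition freq :: "int ^ 'n \<Rightarrow> real ^ 'n" where
  "freq \<xi> = (\<chi> j. real_of_int (\<xi> $ j))"

definition l1_norm :: "int ^ 'n \<Rightarrow> real" where
  "l1_norm \<xi> = (\<Sum>j\<in>UNIV. \<bar>real_of_int (\<xi> $ j)\<bar>)"

definition character :: "int ^ 'n \<Rightarrow> real ^ 'n \<Rightarrow> complex" where
  "character \<xi> x = exp (\<i> * complex_of_real (x \<bullet> freq \<xi>))"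

definition partial_deriv :: "'n \<Rightarrow> (real ^ 'n \<Rightarrow> complex) \<Rightarrow> real ^ 'n \<Rightarrow> complex" where
  "partial_deriv j f x = frechet_derivative f (at x) (axis j 1)"

definition partial_derivs :: "'n list \<Rightarrow> (real ^ 'n \<Rightarrow> complex) \<Rightarrow> real ^ 'n \<Rightarrow> complex" where
  "partial_derivs js f = foldr partial_deriv js f"

text \<open>Smooth functions on the torus. The list \<open>js\<close> ranges over all finite sequences of coordinate
  directions, including the empty one, so all iterated partial derivatives exist and are
  (totally) differentiable, hence continuous.\<close>

definition smooth_torus :: "(real ^ 'n \<Rightarrow> complex) set" where
  "smooth_torus = {f. (\<forall>j x. f (x + axis j (2 * pi)) = f x) \<and>
                      (\<forall>js x. partial_derivs js f differentiable (at x))}"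

text \<open>Distributions: continuous linear functionals on \<open>C\<^sup>\<infinity>(\<bbbT>\<^sup>n)\<close>. The topology of
  \<open>C\<^sup>\<infinity>(\<bbbT>\<^sup>n)\<close> (uniform convergence of all derivatives) is metrizable, so continuity is sequential
  continuity. Membership in \<open>extensional\<close> only fixes the irrelevant values outside
  \<open>C\<^sup>\<infinity>(\<bbbT>\<^sup>n)\<close>, so that equality of distributions is equality in HOL.\<close>

type_synonym 'n functional = "(real ^ 'n \<Rightarrow> complex) \<Rightarrow> complex"

definition distributions :: "'n::finite functional set" where
  "distributions = {u \<in> extensional smooth_torus.
     (\<forall>f\<in>smooth_torus. \<forall>g\<in>smooth_torus. \<forall>a b. u (\<lambda>x. a * f x + b * g x) = a * u f + b * u g) \<and>
     (\<forall>F f. (\<forall>i::nat. F i \<in> smooth_torus) \<longrightarrow> f \<in> smooth_torus \<longrightarrow>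
        (\<forall>js. uniform_limit UNIV (\<lambda>i. partial_derivs js (F i)) (partial_derivs js f) sequentially) \<longrightarrow>
        (\<lambda>i. u (F i)) \<longlonglongrightarrow> u f)}"

definition fourier_coeff :: "'n::finite functional \<Rightarrow> int ^ 'n \<Rightarrow> complex" where
  "fourier_coeff u \<xi> = u (character (- \<xi>)) / complex_of_real ((2 * pi) ^ CARD('n))"

text \<open>\<open>C\<^sup>\<infinity>(\<bbbT>\<^sup>n)\<close> as a subspace of \<open>\<D>'(\<bbbT>\<^sup>n)\<close>: a smooth function acts by integration over a
  fundamental domain.\<close>

definition smooth_distributions :: "'n::finite functional set" where
  "smooth_distributions = {u \<in> distributions. \<exists>f\<in>smooth_torus. \<forall>g\<in>smooth_torus.
     u g = integral (cbox 0 (\<chi> j. 2 * pi)) (\<lambda>x. f x * g x)}"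

definition sobolev :: "real \<Rightarrow> 'n::finite functional set" where
  "sobolev k = {u \<in> distributions.
     (\<lambda>\<xi>. (1 + (norm (freq \<xi>))\<^sup>2) powr k * (cmod (fourier_coeff u \<xi>))\<^sup>2) summable_on UNIV}"

definition symbol_of_order :: "real \<Rightarrow> (int ^ 'n \<Rightarrow> complex) \<Rightarrow> bool" where
  "symbol_of_order m p \<longleftrightarrow>
     (\<exists>C>0. \<forall>\<xi>. cmod (p \<xi>) \<le> C * (1 + (norm (freq \<xi>))\<^sup>2) powr (m / 2))"

text \<open>The operator \<open>p(D)\<close>. For a symbol \<open>p\<close> of some order and a distribution \<open>u\<close>, exactly one
  distribution has the prescribed Fourier coefficients.\<close>

definition fourier_multiplier ::
    "(int ^ 'n \<Rightarrow> complex) \<Rightarrow> 'n::finite functional \<Rightarrow> 'n functional" where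
  "fourier_multiplier p u =
     (THE v. v \<in> distributions \<and> (\<forall>\<xi>. fourier_coeff v \<xi> = p \<xi> * fourier_coeff u \<xi>))"

definition globally_hypoelliptic :: "(int ^ 'n::finite \<Rightarrow> complex) \<Rightarrow> bool" where
  "globally_hypoelliptic p \<longleftrightarrow>
     (\<forall>u\<in>distributions. fourier_multiplier p u \<in> smooth_distributions \<longrightarrow> u \<in> smooth_distributions)"

definition symbol_lower_bound :: "real \<Rightarrow> (int ^ 'n::finite \<Rightarrow> complex) \<Rightarrow> real \<Rightarrow> bool" where
  "symbol_lower_bound m p r \<longleftrightarrow> finite {\<xi>. p \<xi> = 0} \<and>
     (\<exists>C>0. \<forall>\<xi>. \<xi> \<noteq> 0 \<longrightarrow> p \<xi> \<noteq> 0 \<longrightarrow> cmod (p \<xi>) \<ge> C * l1_norm \<xi> powr (m - r))"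

definition sobolev_regularity :: "real \<Rightarrow> (int ^ 'n::finite \<Rightarrow> complex) \<Rightarrow> real \<Rightarrow> bool" where
  "sobolev_regularity m p r \<longleftrightarrow>
     (\<forall>k. \<forall>u\<in>distributions. fourier_multiplier p u \<in> sobolev k \<longrightarrow> u \<in> sobolev (k + m - r))"

end

theory Submission
  imports Defs
begin

text \<open>
  Passing to Fourier coefficients identifies distributions with the families on the lattice of at
  most polynomial growth, and smooth functions with the rapidly decreasing ones; \<open>p(D)\<close> becomes
  multiplication by \<open>p\<close>. The lower bound for \<open>p\<close> then gives both kinds of regularity by comparing
  coefficients. Conversely, if \<open>p\<close> has infinitely many zeros or the lower bound fails, there is an
  infinite set of frequencies on which \<open>p\<close> is too small, and a distribution whose coefficients live
  on that set is a singular \<open>u\<close> with \<open>p(D)u\<close> regular. The identification rests on the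
  completeness of the characters, proved by testing against powers of a trigonometric polynomial with
  a single peak.
\<close>

section \<open>Families indexed by frequencies\<close>

text \<open>The weight \<open>wt\<close> stands in for both norms of the statement: it is at least 1
  everywhere, so its powers increase with the exponent and the frequency 0 needs no exception; being
  comparable to the square of a norm, it carries halved exponents. Continuity of a distribution is
  only sequential and involves all derivatives at once, so neither polynomial growth of the
  coefficients nor a finite order is given. Growth is forced by a diagonal sequence of test
  functions; the converse needs decay estimates whose constants do not depend on the test function.
  Several variables are handled without iterated integrals: translation invariance of the integral
  over the cell yields integration by parts, hence both decay and orthogonality. In the converse
  directions one value of \<open>k\<close> settles each half of the lower bound:
  \<open>k = r - m\<close> for the zeros of \<open>p\<close>, \<open>k = 0\<close> for the estimate.
  In the hypoelliptic case the estimate fails for all natural exponents simultaneously, and a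
  diagonal choice of frequencies makes \<open>p\<close> decay along them faster than every
  power.\<close>

definition wt :: "int ^ 'n::finite \<Rightarrow> real" where
  "wt \<xi> = 1 + (norm (freq \<xi>))\<^sup>2"

definition rapid :: "(int ^ 'n::finite \<Rightarrow> complex) \<Rightarrow> bool" where
  "rapid a \<longleftrightarrow> (\<forall>N. \<exists>C. \<forall>\<xi>. cmod (a \<xi>) * wt \<xi> ^ N \<le> C)"

definition tempered :: "(int ^ 'n::finite \<Rightarrow> complex) \<Rightarrow> bool" where
  "tempered a \<longleftrightarrow> (\<exists>N C. \<forall>\<xi>. cmod (a \<xi>) \<le> C * wt \<xi> ^ N)"

lemma wt_eq_sum: "wt \<xi> = 1 + (\<Sum>j\<in>UNIV. (real_of_int (\<xi> $ j))\<^sup>2)"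
  unfolding wt_def power2_norm_eq_inner inner_vec_def by (simp add: freq_def power2_eq_square)

lemma wt_ge_coord: "1 + (real_of_int (\<xi> $ j))\<^sup>2 \<le> wt \<xi>"
  unfolding wt_eq_sum using member_le_sum[of j UNIV "\<lambda>j. (real_of_int (\<xi> $ j))\<^sup>2"] by simp

lemma wt_ge_1: "1 \<le> wt \<xi>"
  by (simp add: wt_def)

lemma wt_pos: "0 < wt \<xi>"
  using wt_ge_1[of \<xi>] by simp

lemma wt_nonzero [simp]: "wt \<xi> \<noteq> 0"
  using wt_pos[of \<xi>] by simp

lemma wt_minus [simp]: "wt (- \<xi>) = wt \<xi>"
  by (simp add: wt_eq_sum)

lemma abs_coord_le_wt: "\<bar>real_of_int (\<xi> $ j)\<bar> \<le> wt \<xi>"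
proof -
  have "0 \<le> (\<bar>real_of_int (\<xi> $ j)\<bar> - 1)\<^sup>2" by (rule zero_le_power2)
  then have "2 * \<bar>real_of_int (\<xi> $ j)\<bar> \<le> 1 + (real_of_int (\<xi> $ j))\<^sup>2"
    by (simp add: power2_diff)
  then show ?thesis using wt_ge_coord[of \<xi> j] by linarith
qed

lemma wt_power_mono: "M \<le> N \<Longrightarrow> wt \<xi> ^ M \<le> wt \<xi> ^ N"
  by (rule power_increasing[OF _ wt_ge_1])

lemma infinite_freqs: "infinite (UNIV :: (int ^ 'n::finite) set)"
proof -
  have "inj (\<lambda>k. \<chi> j::'n. (k::int))"
    by (auto intro!: injI simp: vec_eq_iff)
  then have "infinite (range (\<lambda>k. \<chi> j::'n. (k::int)))"
    using infinite_UNIV_int by (simp add: finite_image_iff)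
  then show ?thesis using finite_subset[OF subset_UNIV] by metis
qed

lemma summable_on_inverse_1_plus_square:
  "(\<lambda>k::int. 1 / (1 + (real_of_int k)\<^sup>2)) summable_on UNIV"
proof -
  have "summable (\<lambda>n::nat. 1 / (1 + (real n)\<^sup>2))"
  proof (rule summable_comparison_test')
    show "summable (\<lambda>n::nat. inverse ((real n)\<^sup>2))"
      by (rule inverse_power_summable) simp
    show "norm (1 / (1 + (real n)\<^sup>2)) \<le> inverse ((real n)\<^sup>2)" if "1 \<le> n" for n
      using that by (auto simp: inverse_eq_divide intro!: divide_left_mono mult_pos_pos add_pos_nonneg)
  qed
  then have nat: "(\<lambda>n::nat. 1 / (1 + (real n)\<^sup>2)) summable_on UNIV"
    by (subst summable_on_UNIV_nonneg_real_iff) auto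
  have "(\<lambda>k::int. 1 / (1 + (real_of_int k)\<^sup>2)) summable_on range int"
    by (subst summable_on_reindex) (use nat in \<open>auto simp: o_def inj_on_def\<close>)
  moreover have "(\<lambda>k::int. 1 / (1 + (real_of_int k)\<^sup>2)) summable_on range (\<lambda>n. - int n)"
    by (subst summable_on_reindex) (use nat in \<open>auto simp: o_def inj_on_def\<close>)
  ultimately have "(\<lambda>k::int. 1 / (1 + (real_of_int k)\<^sup>2)) summable_on (range int \<union> range (\<lambda>n. - int n))"
    by (rule summable_on_union)
  moreover have "range int \<union> range (\<lambda>n. - int n) = UNIV"
  proof -
    have "k \<in> range int \<union> range (\<lambda>n. - int n)" for k
      by (cases k rule: int_cases2) (simp_all add: rangeI)
    then show ?thesis by blast
  qed
  ultimately show ?thesis by simp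
qed

text \<open>Each of the \<open>CARD('n)\<close> factors \<open>1 / wt \<xi>\<close> is at most the
  one-variable term of a different coordinate, so the sum over a box factors into one-variable sums.
  The exponent is not sharp, but it is a natural number and large enough.\<close>

lemma summable_on_wt:
  "(\<lambda>\<xi> :: int ^ 'n::finite. 1 / wt \<xi> ^ CARD('n)) summable_on UNIV"
proof (rule nonneg_bdd_above_summable_on)
  show "0 \<le> 1 / wt \<xi> ^ CARD('n)" for \<xi> :: "int ^ 'n"
    using wt_pos[of \<xi>] by simp
  define h where "h = (\<lambda>k::int. 1 / (1 + (real_of_int k)\<^sup>2))"
  have h0: "h k \<ge> 0" for k by (simp add: h_def)
  have "sum (\<lambda>\<xi> :: int ^ 'n. 1 / wt \<xi> ^ CARD('n)) F \<le> infsum h UNIV ^ CARD('n)" if "finite F" for F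
  proof -
    \<comment> \<open>All coordinates of all members of \<open>F\<close>, so that \<open>F\<close>
      lies in the finite box with side \<open>G\<close>, over which the sum of products is a product
      of sums.\<close>
    define G where "G = (\<Union>\<xi>\<in>F. range (($) \<xi>))"
    have G: "finite G" using that by (simp add: G_def)
    have "1 / wt \<xi> ^ CARD('n) \<le> (\<Prod>j\<in>UNIV. h (\<xi> $ j))" for \<xi> :: "int ^ 'n"
    proof -
      have "(\<Prod>j\<in>(UNIV::'n set). 1 / wt \<xi>) \<le> (\<Prod>j\<in>UNIV. h (\<xi> $ j))"
      proof (rule prod_mono)
        fix j
        have "0 < 1 + (real_of_int (\<xi> $ j))\<^sup>2" by (simp add: add_pos_nonneg)
        then show "0 \<le> 1 / wt \<xi> \<and> 1 / wt \<xi> \<le> h (\<xi> $ j)"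
          using wt_pos[of \<xi>] wt_ge_coord[of \<xi> j] by (auto simp: h_def intro!: divide_left_mono)
      qed
      then show ?thesis by (simp add: power_divide)
    qed
    then have "sum (\<lambda>\<xi> :: int ^ 'n. 1 / wt \<xi> ^ CARD('n)) F \<le> (\<Sum>\<xi>\<in>F. \<Prod>j\<in>UNIV. h (\<xi> $ j))"
      by (intro sum_mono)
    also have "\<dots> = (\<Sum>g\<in>($) ` F. \<Prod>j\<in>UNIV. h (g j))"
      by (subst sum.reindex) (auto simp: inj_on_def vec_nth_inject)
    also have "\<dots> \<le> (\<Sum>g\<in>PiE UNIV (\<lambda>_::'n. G). \<Prod>j\<in>UNIV. h (g j))"
      by (rule sum_mono2) (auto simp: G_def that h0 intro!: prod_nonneg finite_PiE)
    also have "\<dots> = (\<Prod>j\<in>(UNIV::'n set). \<Sum>k\<in>G. h k)"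
      by (subst prod_sum_PiE) (use G in auto)
    also have "\<dots> = (\<Sum>k\<in>G. h k) ^ CARD('n)" by simp
    also have "\<dots> \<le> infsum h UNIV ^ CARD('n)"
    proof (rule power_mono)
      show "sum h G \<le> infsum h UNIV"
        by (rule finite_sum_le_infsum) (use summable_on_inverse_1_plus_square G h0 in \<open>auto simp: h_def\<close>)
    qed (simp add: h0 sum_nonneg)
    finally show ?thesis .
  qed
  then show "bdd_above (sum (\<lambda>\<xi> :: int ^ 'n. 1 / wt \<xi> ^ CARD('n)) ` {F. F \<subseteq> UNIV \<and> finite F})"
    by (intro bdd_aboveI2) auto
qed

lemma rapidD:
  assumes "rapid a"
  obtains C where "C > 0" "\<And>\<xi>. cmod (a \<xi>) * wt \<xi> ^ N \<le> C"
proof -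
  obtain C where "\<And>\<xi>. cmod (a \<xi>) * wt \<xi> ^ N \<le> C"
    using assms unfolding rapid_def by blast
  then have "\<And>\<xi>. cmod (a \<xi>) * wt \<xi> ^ N \<le> max C 1"
    by (meson max.coboundedI1)
  then show ?thesis by (intro that[of "max C 1"]) auto
qed

lemma temperedD:
  assumes "tempered a"
  obtains N C where "C > 0" "\<And>\<xi>. cmod (a \<xi>) \<le> C * wt \<xi> ^ N"
proof -
  obtain N C where *: "\<And>\<xi>. cmod (a \<xi>) \<le> C * wt \<xi> ^ N"
    using assms unfolding tempered_def by blast
  have "cmod (a \<xi>) \<le> max C 1 * wt \<xi> ^ N" for \<xi>
  proof -
    have "C * wt \<xi> ^ N \<le> max C 1 * wt \<xi> ^ N"
      using wt_pos[of \<xi>] by (intro mult_right_mono) auto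
    then show ?thesis using *[of \<xi>] by linarith
  qed
  then show ?thesis by (intro that[of "max C 1"]) auto
qed

lemma rapid_mult_tempered:
  assumes "rapid a" "tempered b"
  shows "rapid (\<lambda>\<xi>. b \<xi> * a \<xi>)"
  unfolding rapid_def
proof
  fix N
  obtain M C where C: "C > 0" "\<And>\<xi>. cmod (b \<xi>) \<le> C * wt \<xi> ^ M" using assms(2) temperedD by blast
  obtain B where B: "B > 0" "\<And>\<xi>. cmod (a \<xi>) * wt \<xi> ^ (M + N) \<le> B" using assms(1) rapidD by blast
  have "cmod (b \<xi> * a \<xi>) * wt \<xi> ^ N \<le> C * B" for \<xi>
  proof -
    have "cmod (b \<xi> * a \<xi>) * wt \<xi> ^ N \<le> (C * wt \<xi> ^ M) * cmod (a \<xi>) * wt \<xi> ^ N"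
      using C(2)[of \<xi>] wt_pos[of \<xi>] by (auto simp: norm_mult intro!: mult_right_mono)
    also have "\<dots> = C * (cmod (a \<xi>) * wt \<xi> ^ (M + N))" by (simp add: power_add)
    also have "\<dots> \<le> C * B" using B(2)[of \<xi>] C(1) by (intro mult_left_mono) auto
    finally show ?thesis .
  qed
  then show "\<exists>C. \<forall>\<xi>. cmod (b \<xi> * a \<xi>) * wt \<xi> ^ N \<le> C" by blast
qed

lemma tempered_mult:
  assumes "tempered a" "tempered b"
  shows "tempered (\<lambda>\<xi>. a \<xi> * b \<xi>)"
proof -
  obtain M C where C: "C > 0" "\<And>\<xi>. cmod (a \<xi>) \<le> C * wt \<xi> ^ M" using assms(1) temperedD by blast
  obtain N B where B: "B > 0" "\<And>\<xi>. cmod (b \<xi>) \<le> B * wt \<xi> ^ N" using assms(2) temperedD by blast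
  have "cmod (a \<xi> * b \<xi>) \<le> (C * B) * wt \<xi> ^ (M + N)" for \<xi>
    using mult_mono[OF C(2) B(2), of \<xi> \<xi>] C(1) wt_pos[of \<xi>] by (simp add: norm_mult power_add mult_ac)
  then show ?thesis unfolding tempered_def by blast
qed

lemma tempered_coord: "tempered (\<lambda>\<xi>. \<i> * of_int (\<xi> $ j))"
  unfolding tempered_def using abs_coord_le_wt
  by (intro exI[of _ 1] exI[of _ "1::real"]) (auto simp: norm_mult)

lemma tempered_indicator: "tempered (\<lambda>\<xi>. if \<xi> \<in> S then 1 else 0)"
  unfolding tempered_def by (rule exI[of _ 0], rule exI[of _ 1]) auto

lemma rapid_abs_summable:
  fixes a :: "int ^ 'n::finite \<Rightarrow> complex"
  assumes "rapid a"
  shows "(\<lambda>\<xi>. cmod (a \<xi>)) summable_on UNIV"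
proof -
  obtain C where C: "\<And>\<xi>. cmod (a \<xi>) * wt \<xi> ^ CARD('n) \<le> C" using assms rapidD by blast
  show ?thesis
  proof (rule summable_on_comparison_test)
    show "(\<lambda>\<xi>::int^'n. C * (1 / wt \<xi> ^ CARD('n))) summable_on UNIV"
      by (intro summable_on_cmult_right summable_on_wt)
    show "cmod (a \<xi>) \<le> C * (1 / wt \<xi> ^ CARD('n))" for \<xi>
      using C[of \<xi>] wt_pos[of \<xi>] by (simp add: field_simps)
  qed auto
qed

section \<open>Tests for finite and infinite sets of frequencies\<close>

lemma summable_on_indicator_imp_finite:
  assumes "(\<lambda>x. if x \<in> S then 1 else 0 :: real) summable_on UNIV"
  shows "finite S"
proof (rule ccontr)
  let ?f = "\<lambda>x. if x \<in> S then 1 else 0 :: real"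
  assume "infinite S"
  obtain n :: nat where n: "infsum ?f UNIV < real n" using reals_Archimedean2 by blast
  obtain F where F: "F \<subseteq> S" "finite F" "card F = n"
    using \<open>infinite S\<close> infinite_arbitrarily_large by blast
  have "real n = sum ?f F" using F by (simp add: sum.If_cases Int_absorb2)
  also have "\<dots> \<le> infsum ?f UNIV"
    by (rule finite_sum_le_infsum) (use assms F in auto)
  finally show False using n by simp
qed

text \<open>Frequencies picked by choice may repeat. Summing over a set of representatives on which
  \<open>g\<close> is injective removes the repetitions.\<close>

lemma summable_on_range:
  fixes f :: "'a \<Rightarrow> real"
  assumes "(\<lambda>i. f (g i)) summable_on UNIV"
  shows "f summable_on range g"
proof -
  obtain T where T: "inj_on g T" "range g = g ` T"
    using subset_image_inj[of "range g" g UNIV] by auto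
  have "(f \<circ> g) summable_on T"
    using assms by (auto simp: o_def intro: summable_on_subset)
  then show ?thesis using T by (simp add: summable_on_reindex)
qed

text \<open>On a finite range the positive quantity \<open>q\<close> would have a positive minimum,
  which the limit 0 excludes.\<close>

lemma infinite_range_if_tendsto_0:
  fixes q :: "'a \<Rightarrow> real"
  assumes "\<And>i::nat. 0 < q (g i)" "(\<lambda>i. q (g i)) \<longlonglongrightarrow> 0"
  shows "infinite (range g)"
proof
  assume fin: "finite (range g)"
  let ?m = "Min (q ` range g)"
  have "?m > 0" using fin assms(1) by (subst Min_gr_iff) auto
  then obtain i where "q (g i) < ?m"
    using eventually_happens[OF order_tendstoD(2)[OF assms(2)]] by auto
  moreover have "?m \<le> q (g i)" using fin by (intro Min_le) auto
  ultimately show False by simp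
qed

section \<open>Integration over the torus\<close>

abbreviation cell :: "(real ^ 'n::finite) set" where
  "cell \<equiv> cbox 0 (\<chi> j. 2 * pi)"

lemma integral_cbox_split_at:
  fixes F :: "real ^ 'n::finite \<Rightarrow> complex"
  assumes F: "continuous_on UNIV F"
    and le: "cbox a b \<inter> {x. x $ j \<le> c} = cbox a1 b1"
    and ge: "cbox a b \<inter> {x. c \<le> x $ j} = cbox a2 b2"
  shows "integral (cbox a b) F = integral (cbox a1 b1) F + integral (cbox a2 b2) F"
proof (rule integral_unique, rule has_integral_split[where k = "axis j 1" and c = c])
  have "F integrable_on cbox a' b'" for a' b'
    by (rule integrable_continuous[OF continuous_on_subset[OF F subset_UNIV]])
  then have *: "(F has_integral integral (cbox a' b') F) (cbox a' b')" for a' b'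
    by (rule integrable_integral)
  show "(F has_integral integral (cbox a1 b1) F) (cbox a b \<inter> {x. x \<bullet> axis j 1 \<le> c})"
    using * le by (simp add: inner_axis)
  show "(F has_integral integral (cbox a2 b2) F) (cbox a b \<inter> {x. c \<le> x \<bullet> axis j 1})"
    using * ge by (simp add: inner_axis)
qed simp

text \<open>In direction \<open>j\<close> the shifted cell is \<open>[t, 2 pi]\<close> followed by
  \<open>[2 pi, 2 pi + t]\<close>. The second slab is the translate by one period of
  \<open>[0, t]\<close> (the box with upper corner \<open>?bt\<close>), and the two pieces together
  refill the cell.\<close>

lemma integral_cell_translate:
  fixes F :: "real ^ 'n::finite \<Rightarrow> complex"
  assumes F: "continuous_on UNIV F" and per: "\<And>x. F (x + axis j (2 * pi)) = F x"
    and t: "0 \<le> t" "t \<le> 2 * pi"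
  shows "integral cell (\<lambda>x. F (x + axis j t)) = integral cell F"
proof -
  let ?b = "(\<chi> i. 2 * pi) :: real ^ 'n"
  let ?bt = "(\<chi> i. if i = j then t else 2 * pi) :: real ^ 'n"
  have "integral cell (\<lambda>x. F (x + axis j t)) = integral cell (F \<circ> (+) (axis j t))"
    by (simp add: o_def add.commute)
  also have "\<dots> = integral (cbox (0 + axis j t) (?b + axis j t)) F"
    by (rule integral_shift_cbox_plus)
  also have "\<dots> = integral (cbox (axis j t) ?b) F
      + integral (cbox (0 + axis j (2 * pi)) (?bt + axis j (2 * pi))) F"
  proof (rule integral_cbox_split_at[OF F, where j = j and c = "2 * pi"]; rule set_eqI)
    fix x :: "real ^ 'n"
    have "x \<in> cbox (0 + axis j t) (?b + axis j t) \<inter> {x. x $ j \<le> 2 * pi}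
        \<longleftrightarrow> (\<forall>i. (0 + axis j t :: real ^ 'n) $ i \<le> x $ i \<and> x $ i \<le> (?b + axis j t) $ i \<and> (i = j \<longrightarrow> x $ i \<le> 2 * pi))"
      by (auto simp: mem_box_cart)
    also have "\<dots> \<longleftrightarrow> x \<in> cbox (axis j t) ?b"
      unfolding mem_box_cart using t by (intro arg_cong[where f = All] ext) (auto simp: axis_def)
    finally show "x \<in> cbox (0 + axis j t) (?b + axis j t) \<inter> {x. x $ j \<le> 2 * pi}
        \<longleftrightarrow> x \<in> cbox (axis j t) ?b" .
  next
    fix x :: "real ^ 'n"
    have "x \<in> cbox (0 + axis j t) (?b + axis j t) \<inter> {x. 2 * pi \<le> x $ j}
        \<longleftrightarrow> (\<forall>i. (0 + axis j t :: real ^ 'n) $ i \<le> x $ i \<and> x $ i \<le> (?b + axis j t) $ i \<and> (i = j \<longrightarrow> 2 * pi \<le> x $ i))"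
      by (auto simp: mem_box_cart)
    also have "\<dots> \<longleftrightarrow> x \<in> cbox (0 + axis j (2 * pi)) (?bt + axis j (2 * pi))"
      unfolding mem_box_cart using t by (intro arg_cong[where f = All] ext) (auto simp: axis_def)
    finally show "x \<in> cbox (0 + axis j t) (?b + axis j t) \<inter> {x. 2 * pi \<le> x $ j}
        \<longleftrightarrow> x \<in> cbox (0 + axis j (2 * pi)) (?bt + axis j (2 * pi))" .
  qed
  also have "integral (cbox (0 + axis j (2 * pi)) (?bt + axis j (2 * pi))) F
      = integral (cbox 0 ?bt) (F \<circ> (+) (axis j (2 * pi)))"
    by (rule integral_shift_cbox_plus[symmetric])
  also have "F \<circ> (+) (axis j (2 * pi)) = F"
    using per by (auto simp: o_def add.commute)
  also have "integral (cbox (axis j t) ?b) F + integral (cbox 0 ?bt) F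
      = integral (cbox 0 ?bt) F + integral (cbox (axis j t) ?b) F"
    by (rule add.commute)
  also have "\<dots> = integral cell F"
  proof (rule integral_cbox_split_at[OF F, where j = j and c = t, symmetric]; rule set_eqI)
    fix x :: "real ^ 'n"
    have "x \<in> cell \<inter> {x. x $ j \<le> t}
        \<longleftrightarrow> (\<forall>i. 0 \<le> x $ i \<and> x $ i \<le> 2 * pi \<and> (i = j \<longrightarrow> x $ i \<le> t))"
      by (auto simp: mem_box_cart)
    also have "\<dots> \<longleftrightarrow> x \<in> cbox 0 ?bt"
      unfolding mem_box_cart using t by (intro arg_cong[where f = All] ext) (auto simp: axis_def)
    finally show "x \<in> cell \<inter> {x. x $ j \<le> t}
        \<longleftrightarrow> x \<in> cbox 0 ?bt" .
  next
    fix x :: "real ^ 'n"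
    have "x \<in> cell \<inter> {x. t \<le> x $ j}
        \<longleftrightarrow> (\<forall>i. 0 \<le> x $ i \<and> x $ i \<le> 2 * pi \<and> (i = j \<longrightarrow> t \<le> x $ i))"
      by (auto simp: mem_box_cart)
    also have "\<dots> \<longleftrightarrow> x \<in> cbox (axis j t) ?b"
      unfolding mem_box_cart using t by (intro arg_cong[where f = All] ext) (auto simp: axis_def)
    finally show "x \<in> cell \<inter> {x. t \<le> x $ j}
        \<longleftrightarrow> x \<in> cbox (axis j t) ?b" .
  qed
  finally show ?thesis .
qed

text \<open>The integral over the cell of a translate of \<open>F\<close> does not depend on the translation, so
  differentiating it under the integral sign gives \<open>0\<close>; this replaces integration by parts in
  one variable together with Fubini.\<close>

lemma integral_cell_partial_deriv:
  fixes F :: "real ^ 'n::finite \<Rightarrow> complex"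
  assumes per: "\<And>x. F (x + axis j (2 * pi)) = F x"
    and diff: "\<And>x. F differentiable at x"
    and cont: "continuous_on UNIV (partial_deriv j F)"
  shows "integral cell (partial_deriv j F) = 0"
proof -
  have F: "continuous_on UNIV F"
    using diff by (intro differentiable_imp_continuous_on) (simp add: differentiable_on_def)
  have axis: "axis j t = t *\<^sub>R axis j (1::real)" for t
    by (simp add: vec_eq_iff axis_def)
  define G where "G = (\<lambda>t. integral cell (\<lambda>x. F (x + t *\<^sub>R axis j 1)))"
  \<comment> \<open>Translation invariance is available only for shifts in \<open>[0, 2 pi]\<close>,
    so the derivative is taken at the left end of \<open>[0, 1]\<close>; one-sided derivatives are
    still unique there.\<close>
  have "(G has_vector_derivative integral cell (\<lambda>x. partial_deriv j F (x + 0 *\<^sub>R axis j 1)))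
      (at 0 within cbox 0 1)"
    unfolding G_def
  proof (rule leibniz_rule_vector_derivative)
    fix t :: real and x :: "real ^ 'n"
    let ?D = "frechet_derivative F (at (x + t *\<^sub>R axis j 1))"
    have D: "(F has_derivative ?D) (at (x + t *\<^sub>R axis j 1))"
      using diff by (simp add: frechet_derivative_works)
    have "((\<lambda>s. x + s *\<^sub>R axis j 1) has_derivative (\<lambda>s. s *\<^sub>R axis j 1)) (at t within cbox 0 1)"
      by (auto intro!: derivative_eq_intros)
    from has_derivative_compose[OF this D]
    show "((\<lambda>s. F (x + s *\<^sub>R axis j 1)) has_vector_derivative partial_deriv j F (x + t *\<^sub>R axis j 1))
        (at t within cbox 0 1)"
      using linear_scale[OF has_derivative_linear[OF D]]
      by (simp add: has_vector_derivative_def partial_deriv_def)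
  next
    show "(\<lambda>x. F (x + t *\<^sub>R axis j 1)) integrable_on cell" for t
      by (intro integrable_continuous continuous_on_compose2[OF F] continuous_intros) auto
    show "continuous_on (cbox 0 1 \<times> cell) (\<lambda>(t, x). partial_deriv j F (x + t *\<^sub>R axis j 1))"
      unfolding split_beta by (intro continuous_on_compose2[OF cont] continuous_intros) auto
    show "(0::real) \<in> cbox 0 1" by simp
    show "convex (cbox 0 (1::real))" by (rule convex_box(1))
  qed
  moreover have "(G has_vector_derivative 0) (at 0 within cbox 0 1)"
  proof (rule has_vector_derivative_transform)
    show "((\<lambda>_. integral cell F) has_vector_derivative 0) (at 0 within cbox 0 1)" by simp
    show "G t = integral cell F" if "t \<in> cbox 0 1" for t
      using integral_cell_translate[OF F per, of t] that pi_ge_two unfolding G_def axis[symmetric] by auto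
    show "(0::real) \<in> cbox 0 1" by simp
  qed
  ultimately show ?thesis
    using vector_derivative_unique_within_closed_interval[of 0 1 0 G] by auto
qed

section \<open>Calculus of smooth periodic functions\<close>

lemma smooth_torus_periodic: "f \<in> smooth_torus \<Longrightarrow> f (x + axis j (2 * pi)) = f x"
  by (simp add: smooth_torus_def)

lemma partial_derivs_Nil [simp]: "partial_derivs [] f = f"
  and partial_derivs_Cons [simp]: "partial_derivs (j # js) f = partial_deriv j (partial_derivs js f)"
  by (simp_all add: partial_derivs_def)

lemma partial_derivs_append: "partial_derivs (is @ js) f = partial_derivs is (partial_derivs js f)"
  by (simp add: partial_derivs_def)

lemma smooth_torus_differentiable: "f \<in> smooth_torus \<Longrightarrow> partial_derivs js f differentiable at x"
  by (simp add: smooth_torus_def)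

lemma smooth_torus_continuous_on: "f \<in> smooth_torus \<Longrightarrow> continuous_on S (partial_derivs js f)"
  by (intro continuous_at_imp_continuous_on ballI differentiable_imp_continuous_within)
    (rule smooth_torus_differentiable)

lemma partial_deriv_eqI:
  assumes "(f has_derivative D) (at x)"
  shows "partial_deriv j f x = D (axis j 1)"
  using frechet_derivative_at[OF assms] by (simp add: partial_deriv_def)

lemma partial_deriv_smooth_torus:
  fixes f :: "real ^ 'n::finite \<Rightarrow> complex"
  assumes "f \<in> smooth_torus"
  shows "partial_deriv j f \<in> smooth_torus"
proof -
  have "partial_deriv j f (x + axis i (2 * pi)) = partial_deriv j f x" for i x
  proof -
    let ?v = "axis i (2 * pi) :: real ^ 'n"
    have "f differentiable at (x + ?v)" using smooth_torus_differentiable[OF assms, of "[]"] by simp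
    then have "(f has_derivative frechet_derivative f (at (x + ?v))) (at (x + ?v))"
      by (simp add: frechet_derivative_works)
    then have "((\<lambda>y. f (y + ?v)) has_derivative frechet_derivative f (at (x + ?v))) (at x)"
      by (rule has_derivative_compose[rotated, THEN has_derivative_eq_rhs])
        (auto intro!: derivative_eq_intros)
    then have "(f has_derivative frechet_derivative f (at (x + ?v))) (at x)"
      using smooth_torus_periodic[OF assms] by simp
    then show ?thesis by (simp add: partial_deriv_eqI) (simp add: partial_deriv_def)
  qed
  moreover have "partial_derivs js (partial_deriv j f) differentiable at x" for js x
    using smooth_torus_differentiable[OF assms, of "js @ [j]" x] by (simp add: partial_derivs_append)
  ultimately show ?thesis by (simp add: smooth_torus_def)
qed

lemma partial_derivs_smooth_torus: "f \<in> smooth_torus \<Longrightarrow> partial_derivs js f \<in> smooth_torus"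
  by (induction js) (simp_all add: partial_deriv_smooth_torus)

lemma partial_derivs_lincomb:
  fixes f g :: "real ^ 'n::finite \<Rightarrow> complex"
  assumes "f \<in> smooth_torus" "g \<in> smooth_torus"
  shows "partial_derivs js (\<lambda>x. a * f x + b * g x)
    = (\<lambda>x. a * partial_derivs js f x + b * partial_derivs js g x)"
proof (induction js)
  case (Cons j js)
  have d: "(partial_derivs js h has_derivative frechet_derivative (partial_derivs js h) (at x)) (at x)"
    if "h \<in> smooth_torus" for h and x :: "real ^ 'n"
    using smooth_torus_differentiable[OF that] by (simp add: frechet_derivative_works)
  have "partial_deriv j (\<lambda>x. a * partial_derivs js f x + b * partial_derivs js g x) x =
      a * partial_derivs (j # js) f x + b * partial_derivs (j # js) g x" for x
    by (rule partial_deriv_eqI[THEN trans])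
      (auto intro!: derivative_eq_intros d assms simp: partial_deriv_def)
  then show ?case by (simp add: Cons)
qed simp

lemma smooth_torus_lincomb:
  fixes f g :: "real ^ 'n::finite \<Rightarrow> complex"
  assumes "f \<in> smooth_torus" "g \<in> smooth_torus"
  shows "(\<lambda>x. a * f x + b * g x) \<in> smooth_torus"
proof -
  have "(\<lambda>x. a * partial_derivs js f x + b * partial_derivs js g x) differentiable at x" for js x
    using assms by (intro differentiable_add differentiable_mult differentiable_const smooth_torus_differentiable)
  then show ?thesis
    using assms by (simp add: smooth_torus_def partial_derivs_lincomb[OF assms])
qed

text \<open>There are only finitely many lists of directions of length at most \<open>K\<close>, and
  each derivative is bounded on the compact cell.\<close>

lemma smooth_torus_bounded_on_cell:
  assumes "f \<in> smooth_torus"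
  shows "\<exists>B. \<forall>js x. length js \<le> K \<longrightarrow> x \<in> cell \<longrightarrow> cmod (partial_derivs js f x) \<le> B"
proof -
  let ?L = "{js :: 'a list. length js \<le> K}"
  have fin: "finite ?L" using finite_lists_length_le[of "UNIV :: 'a set" K] by simp
  have "\<exists>B. \<forall>x\<in>cell. cmod (partial_derivs js f x) \<le> B" for js
  proof -
    have "compact (partial_derivs js f ` cell)"
      by (intro compact_continuous_image smooth_torus_continuous_on assms compact_cbox)
    then have "bounded (partial_derivs js f ` cell)" by (rule compact_imp_bounded)
    then show ?thesis unfolding bounded_iff by blast
  qed
  then obtain B where B: "\<And>js x. x \<in> cell \<Longrightarrow> cmod (partial_derivs js f x) \<le> B js" by metis
  have "cmod (partial_derivs js f x) \<le> Max (B ` ?L)" if "length js \<le> K" "x \<in> cell" for js x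
  proof -
    have "B js \<le> Max (B ` ?L)" using fin that(1) by (intro Max_ge) auto
    then show ?thesis using B[OF that(2), of js] by linarith
  qed
  then show ?thesis by blast
qed

section \<open>Characters and Fourier integrals\<close>

lemma character_continuous: "continuous_on S (character \<xi>)"
  unfolding character_def by (intro continuous_intros)

lemma norm_character [simp]: "cmod (character \<xi> x) = 1"
  by (simp add: character_def)

lemma freq_add: "freq (\<xi> + \<eta>) = freq \<xi> + freq \<eta>"
  by (simp add: freq_def vec_eq_iff)

lemma character_mult: "character \<xi> x * character \<eta> x = character (\<xi> + \<eta>) x"
  by (simp add: character_def freq_add inner_add_right exp_add[symmetric] ring_distribs)

lemma character_0 [simp]: "character 0 x = 1"
  by (simp add: character_def freq_def zero_vec_def[symmetric])

lemma character_periodic: "character \<xi> (x + axis j (2 * pi)) = character \<xi> x"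
proof -
  have "character \<xi> (x + axis j (2 * pi)) = character \<xi> x * exp (2 * of_int (\<xi> $ j) * of_real pi * \<i>)"
    by (simp add: character_def inner_add_left inner_axis' freq_def exp_add[symmetric] ring_distribs mult_ac)
  then show ?thesis using exp_integer_2pi[OF Ints_of_int, of "\<xi> $ j"] by simp
qed

lemma character_has_derivative:
  "(character \<xi> has_derivative (\<lambda>h. \<i> * complex_of_real (h \<bullet> freq \<xi>) * character \<xi> x)) (at x)"
proof -
  have "((\<lambda>x. \<i> * complex_of_real (x \<bullet> freq \<xi>)) has_derivative (\<lambda>h. \<i> * complex_of_real (h \<bullet> freq \<xi>))) (at x)"
    by (auto intro!: derivative_eq_intros)
  from has_derivative_compose[OF this DERIV_exp[unfolded has_field_derivative_def]]
  show ?thesis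
    unfolding character_def[abs_def] by (simp add: mult.commute)
qed

lemma axis_inner_freq: "axis j 1 \<bullet> freq \<xi> = real_of_int (\<xi> $ j)"
  by (simp add: inner_axis' freq_def)

lemma partial_deriv_character:
  "partial_deriv j (character \<xi>) x = \<i> * of_int (\<xi> $ j) * character \<xi> x"
  by (simp add: partial_deriv_eqI[OF character_has_derivative] axis_inner_freq)

text \<open>Neither normalised nor conjugated: this is \<open>(2 * pi) ^ CARD('n)\<close> times the
  Fourier coefficient of \<open>f\<close> at \<open>- \<xi>\<close>. With this sign a distribution
  with coefficients \<open>a\<close> acts on \<open>f\<close> by summing
  \<open>a \<xi> * fint f \<xi>\<close>, with no reflection.\<close>

definition fint :: "(real ^ 'n::finite \<Rightarrow> complex) \<Rightarrow> int ^ 'n \<Rightarrow> complex" where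
  "fint f \<xi> = integral cell (\<lambda>x. f x * character \<xi> x)"

lemma integrable_mult_character:
  assumes "continuous_on UNIV f"
  shows "(\<lambda>x. f x * character \<xi> x) integrable_on cell"
  by (rule integrable_continuous, rule continuous_on_mult[OF continuous_on_subset[OF assms subset_UNIV]])
    (rule character_continuous)

text \<open>Integration by parts: the derivative of the periodic product of \<open>f\<close> with a
  character integrates to 0, and the product rule splits it into the two terms compared
  here.\<close>

lemma fint_partial_deriv:
  fixes f :: "real ^ 'n::finite \<Rightarrow> complex"
  assumes "f \<in> smooth_torus"
  shows "fint (partial_deriv j f) \<xi> = - (\<i> * of_int (\<xi> $ j)) * fint f \<xi>"
proof -
  note d0 = smooth_torus_differentiable[OF assms, of "[]", simplified]
  note c0 = smooth_torus_continuous_on[OF assms, of _ "[]", simplified]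
  note c1 = smooth_torus_continuous_on[OF assms, of _ "[j]", simplified]
  let ?F = "\<lambda>x. f x * character \<xi> x"
  have hd: "(?F has_derivative (\<lambda>h. f x * (\<i> * complex_of_real (h \<bullet> freq \<xi>) * character \<xi> x)
      + frechet_derivative f (at x) h * character \<xi> x)) (at x)" for x
    using d0[of x] by (intro has_derivative_mult character_has_derivative) (simp add: frechet_derivative_works)
  have pd: "partial_deriv j ?F = (\<lambda>x. \<i> * of_int (\<xi> $ j) * ?F x + partial_deriv j f x * character \<xi> x)"
    by (rule ext, simp add: partial_deriv_eqI[OF hd] axis_inner_freq) (simp add: partial_deriv_def)
  have "integral cell (partial_deriv j ?F) = 0"
  proof (rule integral_cell_partial_deriv)
    show "?F (x + axis j (2 * pi)) = ?F x" for x
      by (simp add: character_periodic smooth_torus_periodic[OF assms])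
    show "?F differentiable at x" for x using hd differentiableI by blast
    show "continuous_on UNIV (partial_deriv j ?F)"
      unfolding pd by (intro continuous_intros character_continuous c0 c1)
  qed
  then have "\<i> * of_int (\<xi> $ j) * integral cell ?F + integral cell (\<lambda>x. partial_deriv j f x * character \<xi> x) = 0"
    unfolding pd using integrable_mult_character[OF c0] integrable_mult_character[OF c1]
    by (subst (asm) integral_add) (auto intro: integrable_on_mult_right)
  from minus_unique[OF this] show ?thesis unfolding fint_def by (simp only: mult_minus_left)
qed

lemma fint_partial_derivs_replicate:
  assumes "f \<in> smooth_torus"
  shows "fint (partial_derivs (replicate n j) f) \<xi> = (- (\<i> * of_int (\<xi> $ j))) ^ n * fint f \<xi>"
  by (induction n) (simp_all add: fint_partial_deriv partial_derivs_smooth_torus[OF assms] mult_ac)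

lemma measure_cell: "measure lborel (cell :: (real ^ 'n::finite) set) = (2 * pi) ^ CARD('n)"
  by (subst content_cbox_cart) (auto simp: interval_ne_empty_cart)

lemma norm_fint_le:
  fixes f :: "real ^ 'n::finite \<Rightarrow> complex"
  assumes "continuous_on UNIV f" "\<And>x. x \<in> cell \<Longrightarrow> cmod (f x) \<le> B"
  shows "cmod (fint f \<xi>) \<le> B * (2 * pi) ^ CARD('n)"
proof -
  have "cmod (f 0) \<le> B" by (rule assms(2)) (simp add: mem_box_cart)
  then have "0 \<le> B" using norm_ge_zero order_trans by blast
  have "cmod (fint f \<xi>) \<le> B * measure lborel (cell :: (real ^ 'n) set)"
    unfolding fint_def
    by (rule has_integral_bound[OF \<open>0 \<le> B\<close> integrable_integral[OF integrable_mult_character[OF assms(1)]]])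
      (use assms(2) in \<open>simp add: norm_mult\<close>)
  then show ?thesis by (simp add: measure_cell)
qed

text \<open>The weight is the sum of the \<open>CARD('n) + 1\<close> numbers 1 and the squared
  coordinates, so at least one of them reaches the average.\<close>

lemma wt_dominated:
  fixes \<xi> :: "int ^ 'n::finite"
  shows "wt \<xi> \<le> real CARD('n) + 1 \<or> (\<exists>j. wt \<xi> \<le> (real CARD('n) + 1) * (real_of_int (\<xi> $ j))\<^sup>2)"
proof (rule ccontr)
  assume neg: "\<not> ?thesis"
  let ?n = "real CARD('n) + 1"
  have "(\<Sum>j\<in>(UNIV :: 'n set). (real_of_int (\<xi> $ j))\<^sup>2) \<le> (\<Sum>j\<in>(UNIV :: 'n set). wt \<xi> / ?n)"
    by (rule sum_mono) (use neg in \<open>auto simp: not_le field_simps intro: less_imp_le\<close>)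
  moreover have "1 < wt \<xi> / ?n" using neg by (simp add: not_le field_simps)
  moreover have "wt \<xi> = 1 + (\<Sum>j\<in>UNIV. (real_of_int (\<xi> $ j))\<^sup>2)" by (rule wt_eq_sum)
  ultimately have "wt \<xi> < wt \<xi> / ?n + real CARD('n) * (wt \<xi> / ?n)"
    unfolding sum_constant by linarith
  also have "\<dots> = ?n * (wt \<xi> / ?n)" by (simp only: ring_distribs mult_1)
  also have "\<dots> = wt \<xi>" by simp
  finally show False by simp
qed

text \<open>If 1 dominates the weight, the trivial bound of the integral is enough; if coordinate
  \<open>j\<close> does, \<open>2 * N\<close> integrations by parts in direction \<open>j\<close>
  gain the factor \<open>wt \<xi> ^ N\<close>. The order of the quantifiers matters:
  \<open>C\<close> is chosen before \<open>f\<close>, which enters only through \<open>B\<close>.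
  This uniformity later gives continuity of functionals.\<close>

lemma fint_decay:
  "\<exists>C\<ge>0. \<forall>f\<in>smooth_torus. \<forall>B.
     (\<forall>js x. length js \<le> 2 * N \<longrightarrow> x \<in> cell \<longrightarrow> cmod (partial_derivs js f x) \<le> B) \<longrightarrow>
     (\<forall>\<xi> :: int ^ 'n::finite. cmod (fint f \<xi>) * wt \<xi> ^ N \<le> C * B)"
proof (intro exI conjI ballI allI impI)
  let ?n = "real CARD('n) + 1"
  let ?C = "?n ^ N * (2 * pi) ^ CARD('n)"
  show "0 \<le> ?C" by simp
  fix f :: "real ^ 'n \<Rightarrow> complex" and B \<xi>
  assume f: "f \<in> smooth_torus"
    and B: "\<forall>js x. length js \<le> 2 * N \<longrightarrow> x \<in> cell \<longrightarrow> cmod (partial_derivs js f x) \<le> B"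
  have bd: "cmod (fint (partial_derivs js f) \<xi>) \<le> B * (2 * pi) ^ CARD('n)" if "length js \<le> 2 * N" for js
    using B that by (intro norm_fint_le smooth_torus_continuous_on f) auto
  consider "wt \<xi> \<le> ?n" | j where "wt \<xi> \<le> ?n * (real_of_int (\<xi> $ j))\<^sup>2"
    using wt_dominated[of \<xi>] by blast
  then show "cmod (fint f \<xi>) * wt \<xi> ^ N \<le> ?C * B"
  proof cases
    case 1
    then have "wt \<xi> ^ N \<le> ?n ^ N" using wt_pos[of \<xi>] by (intro power_mono) auto
    then have "cmod (fint f \<xi>) * wt \<xi> ^ N \<le> (B * (2 * pi) ^ CARD('n)) * ?n ^ N"
      using bd[of "[]"] wt_pos[of \<xi>] by (intro mult_mono') auto
    then show ?thesis by (simp add: mult_ac)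
  next
    case (2 j)
    then have "wt \<xi> ^ N \<le> (?n * (real_of_int (\<xi> $ j))\<^sup>2) ^ N" using wt_pos[of \<xi>] by (intro power_mono) auto
    then have "cmod (fint f \<xi>) * wt \<xi> ^ N \<le> cmod (fint f \<xi>) * (?n * (real_of_int (\<xi> $ j))\<^sup>2) ^ N"
      by (intro mult_left_mono) auto
    also have "\<dots> = ?n ^ N * (\<bar>real_of_int (\<xi> $ j)\<bar> ^ (2 * N) * cmod (fint f \<xi>))"
      by (simp add: power_mult_distrib power_mult)
    also have "\<bar>real_of_int (\<xi> $ j)\<bar> ^ (2 * N) * cmod (fint f \<xi>)
        = cmod (fint (partial_derivs (replicate (2 * N) j) f) \<xi>)"
      unfolding fint_partial_derivs_replicate[OF f] by (simp add: norm_mult norm_power)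
    also have "?n ^ N * \<dots> \<le> ?n ^ N * (B * (2 * pi) ^ CARD('n))"
      by (intro mult_left_mono bd) auto
    finally show ?thesis by (simp add: mult_ac)
  qed
qed

lemma rapid_fint:
  fixes f :: "real ^ 'n::finite \<Rightarrow> complex"
  assumes "f \<in> smooth_torus"
  shows "rapid (fint f)"
  unfolding rapid_def
proof
  fix N
  obtain C where C: "\<forall>f\<in>smooth_torus. \<forall>B.
     (\<forall>js x. length js \<le> 2 * N \<longrightarrow> x \<in> cell \<longrightarrow> cmod (partial_derivs js f x) \<le> B) \<longrightarrow>
     (\<forall>\<xi> :: int ^ 'n. cmod (fint f \<xi>) * wt \<xi> ^ N \<le> C * B)"
    using fint_decay[where 'n = 'n, of N] by blast
  obtain B where B: "\<forall>js x. length js \<le> 2 * N \<longrightarrow> x \<in> cell \<longrightarrow> cmod (partial_derivs js f x) \<le> B"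
    using smooth_torus_bounded_on_cell[OF assms] by blast
  have "\<forall>\<xi>. cmod (fint f \<xi>) * wt \<xi> ^ N \<le> C * B" using C[rule_format, OF assms B[rule_format]] by blast
  then show "\<exists>C. \<forall>\<xi>. cmod (fint f \<xi>) * wt \<xi> ^ N \<le> C" by blast
qed

section \<open>Fourier series\<close>

text \<open>A fixed enumeration turns lattice sums into ordinary series, to which the results on
  uniform convergence and termwise differentiation apply. Absolute convergence makes its choice
  immaterial.\<close>

definition freq_enum :: "nat \<Rightarrow> int ^ 'n::finite" where
  "freq_enum = from_nat_into UNIV"

lemma bij_freq_enum: "bij (freq_enum :: nat \<Rightarrow> int ^ 'n::finite)"
  unfolding freq_enum_def by (rule bij_betw_from_nat_into[OF countableI_type infinite_freqs])

lemma freq_enum_surj: "\<exists>k. freq_enum k = \<xi>"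
  using bij_is_surj[OF bij_freq_enum] unfolding surj_def by (auto simp: eq_commute)

lemma freq_enum_eq_iff [simp]: "freq_enum i = freq_enum k \<longleftrightarrow> i = k"
  using bij_is_inj[OF bij_freq_enum] by (rule inj_eq)

lemma summable_freq_enum:
  fixes f :: "int ^ 'n::finite \<Rightarrow> real"
  assumes "f summable_on UNIV"
  shows "summable (\<lambda>i. f (freq_enum i))"
  by (rule summable_on_imp_summable, subst summable_on_reindex_bij_betw[OF bij_freq_enum]) (rule assms)

lemma rapid_summable_enum: "rapid a \<Longrightarrow> summable (\<lambda>i. cmod (a (freq_enum i)))"
  by (rule summable_freq_enum[OF rapid_abs_summable])

section \<open>Rapidly convergent Fourier series and their derivatives\<close>

definition series :: "(int ^ 'n::finite \<Rightarrow> complex) \<Rightarrow> real ^ 'n \<Rightarrow> complex" where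
  "series a x = (\<Sum>i. a (freq_enum i) * character (freq_enum i) x)"

lemma uniform_limit_series:
  assumes "rapid a"
  shows "uniform_limit UNIV (\<lambda>N x. \<Sum>i<N. a (freq_enum i) * character (freq_enum i) x) (series a) sequentially"
  unfolding series_def
  by (rule Weierstrass_m_test[OF _ rapid_summable_enum[OF assms]]) (simp add: norm_mult)

lemma series_sums:
  assumes "rapid a"
  shows "(\<lambda>i. a (freq_enum i) * character (freq_enum i) x) sums series a x"
  unfolding series_def
  by (rule summable_sums, rule summable_norm_cancel)
    (simp add: norm_mult rapid_summable_enum[OF assms])

lemma rapid_coord: "rapid a \<Longrightarrow> rapid (\<lambda>\<xi>. \<i> * of_int (\<xi> $ j) * a \<xi>)"
  by (rule rapid_mult_tempered[OF _ tempered_coord])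

text \<open>The derivatives of the partial sums in direction \<open>h\<close> are combinations, with
  the coordinates of \<open>h\<close> as coefficients, of the partial sums of
  \<open>CARD('n)\<close> series that are again rapid. These converge uniformly in \<open>x\<close>,
  which permits termwise differentiation.\<close>

lemma series_has_derivative:
  fixes a :: "int ^ 'n::finite \<Rightarrow> complex"
  assumes a: "rapid a"
  shows "(series a has_derivative
    (\<lambda>h. \<Sum>j\<in>UNIV. complex_of_real (h $ j) * series (\<lambda>\<xi>. \<i> * of_int (\<xi> $ j) * a \<xi>) x)) (at x)"
proof -
  let ?f = "\<lambda>i (x :: real ^ 'n). a (freq_enum i) * character (freq_enum i) x"
  let ?f' = "\<lambda>i (x :: real ^ 'n) (h :: real ^ 'n).
    a (freq_enum i) * (\<i> * complex_of_real (h \<bullet> freq (freq_enum i)) * character (freq_enum i) x)"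
  let ?b = "\<lambda>j \<xi>. \<i> * of_int (\<xi> $ j) * a \<xi>"
  let ?S = "\<lambda>j n (x :: real ^ 'n). \<Sum>i<n. ?b j (freq_enum i) * character (freq_enum i) x"
  have sum: "(\<Sum>i<n. ?f' i x h) = (\<Sum>j\<in>UNIV. complex_of_real (h $ j) * ?S j n x)" for n x and h :: "real ^ 'n"
  proof -
    have "?f' i x h = (\<Sum>j\<in>UNIV. complex_of_real (h $ j) * (?b j (freq_enum i) * character (freq_enum i) x))" for i
      by (simp add: inner_vec_def freq_def sum_distrib_left sum_distrib_right mult_ac)
    then have "(\<Sum>i<n. ?f' i x h)
        = (\<Sum>i<n. \<Sum>j\<in>UNIV. complex_of_real (h $ j) * (?b j (freq_enum i) * character (freq_enum i) x))"
      by simp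
    also have "\<dots> = (\<Sum>j\<in>UNIV. \<Sum>i<n. complex_of_real (h $ j) * (?b j (freq_enum i) * character (freq_enum i) x))"
      by (rule sum.swap)
    finally show ?thesis by (simp only: sum_distrib_left)
  qed
  have "\<exists>g. \<forall>x\<in>UNIV. (\<lambda>n. ?f n x) sums g x \<and>
      (g has_derivative (\<lambda>h. \<Sum>j\<in>UNIV. complex_of_real (h $ j) * series (?b j) x)) (at x within UNIV)"
  proof (rule has_derivative_series)
    show "(?f n has_derivative ?f' n x) (at x within UNIV)" for n x
      by (rule has_derivative_mult_right[OF character_has_derivative])
    show "(\<lambda>n. ?f n 0) sums series a 0" by (rule series_sums[OF a])
    fix e :: real assume "e > 0"
    \<comment> \<open>The permitted error is shared equally among the coordinates.\<close>
    define d where "d = e / real CARD('n)"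
    have "d > 0" using \<open>e > 0\<close> by (simp add: d_def)
    have "\<forall>\<^sub>F n in sequentially. \<forall>j\<in>UNIV. \<forall>x\<in>UNIV. dist (?S j n x) (series (?b j) x) < d"
      by (rule eventually_ball_finite) (use uniform_limitD[OF uniform_limit_series[OF rapid_coord[OF a]] \<open>d > 0\<close>] in auto)
    then show "\<forall>\<^sub>F n in sequentially. \<forall>x\<in>UNIV. \<forall>h.
        norm ((\<Sum>i<n. ?f' i x h) - (\<Sum>j\<in>UNIV. complex_of_real (h $ j) * series (?b j) x)) \<le> e * norm h"
    proof eventually_elim
      case (elim n)
      show ?case
      proof (intro ballI allI)
        fix x h :: "real ^ 'n"
        have "norm ((\<Sum>i<n. ?f' i x h) - (\<Sum>j\<in>UNIV. complex_of_real (h $ j) * series (?b j) x))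
            = norm (\<Sum>j\<in>UNIV. complex_of_real (h $ j) * (?S j n x - series (?b j) x))"
          unfolding sum by (simp only: sum_subtractf right_diff_distrib)
        also have "\<dots> \<le> (\<Sum>j\<in>(UNIV :: 'n set). norm h * d)"
        proof (rule sum_norm_le)
          fix j :: 'n
          have "norm (?S j n x - series (?b j) x) \<le> d"
            using elim by (simp add: dist_norm less_imp_le)
          then show "norm (complex_of_real (h $ j) * (?S j n x - series (?b j) x)) \<le> norm h * d"
            unfolding norm_mult using component_le_norm_cart[of h j] by (intro mult_mono) auto
        qed
        also have "\<dots> = e * norm h" by (simp add: d_def)
        finally show "norm ((\<Sum>i<n. ?f' i x h) - (\<Sum>j\<in>UNIV. complex_of_real (h $ j) * series (?b j) x))
            \<le> e * norm h" .
      qed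
    qed
  qed auto
  then obtain g where g: "\<And>x. (\<lambda>n. ?f n x) sums g x"
    "\<And>x. (g has_derivative (\<lambda>h. \<Sum>j\<in>UNIV. complex_of_real (h $ j) * series (?b j) x)) (at x)" by auto
  have "g = series a" using sums_unique2[OF g(1) series_sums[OF a]] by (rule ext)
  then show ?thesis using g(2) by simp
qed

lemma partial_deriv_series:
  assumes "rapid a"
  shows "partial_deriv j (series a) = series (\<lambda>\<xi>. \<i> * of_int (\<xi> $ j) * a \<xi>)"
proof
  fix x
  show "partial_deriv j (series a) x = series (\<lambda>\<xi>. \<i> * of_int (\<xi> $ j) * a \<xi>) x"
    unfolding partial_deriv_eqI[OF series_has_derivative[OF assms]]
    by (simp add: axis_def if_distrib[of complex_of_real] if_distribR sum.delta if_distrib cong: if_cong)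
qed

definition deriv_coeff :: "'n list \<Rightarrow> (int ^ 'n::finite \<Rightarrow> complex) \<Rightarrow> int ^ 'n \<Rightarrow> complex" where
  "deriv_coeff js a \<xi> = (\<Prod>j\<leftarrow>js. \<i> * of_int (\<xi> $ j)) * a \<xi>"

lemma deriv_coeff_Nil [simp]: "deriv_coeff [] a = a"
  and deriv_coeff_Cons: "deriv_coeff (j # js) a = (\<lambda>\<xi>. \<i> * of_int (\<xi> $ j) * deriv_coeff js a \<xi>)"
  by (simp_all add: deriv_coeff_def fun_eq_iff)

lemma rapid_deriv_coeff: "rapid a \<Longrightarrow> rapid (deriv_coeff js a)"
  by (induction js) (simp_all add: deriv_coeff_Cons rapid_coord)

lemma partial_derivs_series:
  assumes "rapid a"
  shows "partial_derivs js (series a) = series (deriv_coeff js a)"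
proof (induction js)
  case (Cons j js)
  then show ?case
    using partial_deriv_series[OF rapid_deriv_coeff[OF assms]] by (simp add: deriv_coeff_Cons)
qed simp

lemma series_smooth_torus:
  assumes "rapid a"
  shows "series a \<in> smooth_torus"
proof -
  have "series a (x + axis j (2 * pi)) = series a x" for j x
    by (simp add: series_def character_periodic)
  moreover have "partial_derivs js (series a) differentiable at x" for js x
    unfolding partial_derivs_series[OF assms] differentiable_def
    using series_has_derivative[OF rapid_deriv_coeff[OF assms]] by blast
  ultimately show ?thesis by (simp add: smooth_torus_def)
qed

text \<open>Partial sums become series of the same kind, so the formula for iterated derivatives
  covers them, and convergence of all derivatives reduces to uniform convergence of series with
  other coefficients.\<close>

definition truncate :: "nat \<Rightarrow> (int ^ 'n::finite \<Rightarrow> complex) \<Rightarrow> int ^ 'n \<Rightarrow> complex" where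
  "truncate N a \<xi> = (if \<xi> \<in> freq_enum ` {..<N} then a \<xi> else 0)"

lemma rapid_truncate:
  assumes "rapid a"
  shows "rapid (truncate N a)"
proof -
  from rapid_mult_tempered[OF assms tempered_indicator[of "freq_enum ` {..<N}"]] show ?thesis
    by (rule back_subst[where P = rapid]) (auto simp: truncate_def)
qed

lemma series_truncate:
  "series (truncate N a) x = (\<Sum>i<N. a (freq_enum i) * character (freq_enum i) x)"
proof -
  have "series (truncate N a) x = (\<Sum>i<N. truncate N a (freq_enum i) * character (freq_enum i) x)"
    unfolding series_def by (rule suminf_finite) (auto simp: truncate_def)
  also have "\<dots> = (\<Sum>i<N. a (freq_enum i) * character (freq_enum i) x)"
    by (rule sum.cong) (auto simp: truncate_def)
  finally show ?thesis .
qed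

lemma deriv_coeff_truncate: "deriv_coeff js (truncate N a) = truncate N (deriv_coeff js a)"
  by (auto simp: deriv_coeff_def truncate_def fun_eq_iff)

lemma partial_derivs_series_uniform_limit:
  assumes "rapid a"
  shows "uniform_limit UNIV (\<lambda>N. partial_derivs js (series (truncate N a))) (partial_derivs js (series a)) sequentially"
  unfolding partial_derivs_series[OF assms] partial_derivs_series[OF rapid_truncate[OF assms]]
  unfolding deriv_coeff_truncate series_truncate[abs_def]
  by (rule uniform_limit_series[OF rapid_deriv_coeff[OF assms]])

lemma rapid_single: "rapid (\<lambda>\<eta>. if \<eta> = \<xi> then c else 0)"
  unfolding rapid_def
proof
  fix N
  have "\<forall>\<eta>. cmod (if \<eta> = \<xi> then c else 0) * wt \<eta> ^ N \<le> cmod c * wt \<xi> ^ N"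
    using wt_pos[of \<xi>] by simp
  then show "\<exists>C. \<forall>\<eta>. cmod (if \<eta> = \<xi> then c else 0) * wt \<eta> ^ N \<le> C" by blast
qed

text \<open>Lets characters inherit smoothness from the result on series.\<close>

lemma character_eq_series: "character \<xi> = series (\<lambda>\<eta>. if \<eta> = \<xi> then 1 else 0)"
  for \<xi> :: "int ^ 'n::finite"
proof
  fix x :: "real ^ 'n"
  obtain k where k: "freq_enum k = \<xi>" using freq_enum_surj by blast
  have "(\<lambda>i. if i = k then character (freq_enum i) x else 0) sums character (freq_enum k) x"
    by (rule sums_single)
  moreover have "(\<lambda>i. if i = k then character (freq_enum i) x else 0)
      = (\<lambda>i. (if freq_enum i = \<xi> then 1 else 0) * character (freq_enum i) x)"
    using k by (auto simp: fun_eq_iff)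
  ultimately have "(\<lambda>i. (if freq_enum i = \<xi> then 1 else 0) * character (freq_enum i) x) sums character \<xi> x"
    using k by simp
  then show "character \<xi> x = series (\<lambda>\<eta>. if \<eta> = \<xi> then 1 else 0) x"
    by (rule sums_unique2[OF _ series_sums[OF rapid_single]])
qed

lemma character_smooth_torus [simp]: "character \<xi> \<in> smooth_torus"
  unfolding character_eq_series by (rule series_smooth_torus[OF rapid_single])

lemma partial_derivs_character:
  "partial_derivs js (character \<xi>) = (\<lambda>x. (\<Prod>j\<leftarrow>js. \<i> * of_int (\<xi> $ j)) * character \<xi> x)"
proof (induction js)
  case (Cons j js)
  have "partial_deriv j (\<lambda>x. c * character \<xi> x) x = \<i> * of_int (\<xi> $ j) * c * character \<xi> x" for c x
    unfolding partial_deriv_eqI[OF has_derivative_mult_right[OF character_has_derivative]]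
    by (simp add: axis_inner_freq)
  then show ?case unfolding partial_derivs_Cons Cons by (intro ext) simp
qed simp

text \<open>The series converges uniformly on the cell, even after multiplication by the bounded
  function \<open>g\<close>, so it may be integrated term by term.\<close>

lemma series_integral_sums:
  assumes a: "rapid a" and g: "continuous_on UNIV g"
  shows "(\<lambda>i. a (freq_enum i) * fint g (freq_enum i)) sums integral cell (\<lambda>x. series a x * g x)"
proof -
  let ?t = "\<lambda>i x. a (freq_enum i) * (g x * character (freq_enum i) x)"
  have "compact (g ` cell)"
    by (intro compact_continuous_image continuous_on_subset[OF g subset_UNIV] compact_cbox)
  from compact_imp_bounded[OF this] obtain B where B: "\<And>x. x \<in> cell \<Longrightarrow> cmod (g x) \<le> B"
    unfolding bounded_iff by blast
  have "uniform_limit cell (\<lambda>n x. \<Sum>i<n. ?t i x) (\<lambda>x. \<Sum>i. ?t i x) sequentially"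
  proof (rule Weierstrass_m_test)
    show "summable (\<lambda>i. cmod (a (freq_enum i)) * B)"
      by (rule summable_mult2[OF rapid_summable_enum[OF a]])
    show "norm (?t i x) \<le> cmod (a (freq_enum i)) * B" if "x \<in> cell" for i x
      using B[OF that] by (simp add: norm_mult mult_left_mono)
  qed
  moreover have "(\<lambda>x. \<Sum>i. ?t i x) = (\<lambda>x. series a x * g x)"
  proof
    fix x
    have "(\<lambda>i. a (freq_enum i) * character (freq_enum i) x * g x) sums (series a x * g x)"
      by (rule sums_mult2[OF series_sums[OF a]])
    then show "(\<Sum>i. ?t i x) = series a x * g x" by (simp add: sums_iff mult_ac)
  qed
  ultimately have U: "uniform_limit cell (\<lambda>n x. \<Sum>i<n. ?t i x) (\<lambda>x. series a x * g x) sequentially" by simp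
  have C: "continuous_on cell (\<lambda>x. \<Sum>i<n. ?t i x)" for n
    by (intro continuous_on_sum continuous_on_mult continuous_on_const character_continuous
        continuous_on_subset[OF g subset_UNIV])
  obtain I J where I: "\<And>n. ((\<lambda>x. \<Sum>i<n. ?t i x) has_integral I n) cell"
    and J: "((\<lambda>x. series a x * g x) has_integral J) cell" and lim: "I \<longlonglongrightarrow> J"
    by (rule uniform_limit_integral_cbox[OF U C trivial_limit_sequentially]) (rule that)
  have "I n = (\<Sum>i<n. a (freq_enum i) * fint g (freq_enum i))" for n
  proof (rule has_integral_unique[OF I])
    show "((\<lambda>x. \<Sum>i<n. ?t i x) has_integral (\<Sum>i<n. a (freq_enum i) * fint g (freq_enum i))) cell"
      unfolding fint_def
      by (rule has_integral_sum[OF finite_lessThan])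
        (rule has_integral_mult_right[OF integrable_integral[OF integrable_mult_character[OF g]]])
  qed
  then have "I = (\<lambda>n. \<Sum>i<n. a (freq_enum i) * fint g (freq_enum i))" by (rule ext)
  with lim have "(\<lambda>n. \<Sum>i<n. a (freq_enum i) * fint g (freq_enum i)) \<longlonglongrightarrow> J" by simp
  then show ?thesis unfolding sums_def integral_unique[OF J] .
qed

text \<open>Orthogonality from integration by parts: evaluating the integral of a derivative of
  \<open>character \<eta>\<close> in two ways gives
  \<open>(\<eta> $ j + \<xi> $ j) * fint (character \<eta>) \<xi> = 0\<close>, and some such factor
  is nonzero unless \<open>\<xi> = - \<eta>\<close>.\<close>

lemma fint_character:
  "fint (character \<eta>) \<xi> = (if \<xi> = - \<eta> then complex_of_real ((2 * pi) ^ CARD('n)) else 0)"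
  for \<eta> \<xi> :: "int ^ 'n::finite"
proof (cases "\<xi> = - \<eta>")
  case True
  then have "fint (character \<eta>) \<xi> = integral cell (\<lambda>x :: real ^ 'n. 1 :: complex)"
    by (simp add: fint_def character_mult)
  also have "\<dots> = complex_of_real ((2 * pi) ^ CARD('n))"
    by (simp add: measure_cell scaleR_conv_of_real)
  finally show ?thesis using True by simp
next
  case False
  then obtain j where j: "\<xi> $ j \<noteq> - \<eta> $ j" by (auto simp: vec_eq_iff)
  have "partial_deriv j (character \<eta>) = (\<lambda>x. \<i> * of_int (\<eta> $ j) * character \<eta> x)"
    by (rule ext) (rule partial_deriv_character)
  then have "fint (partial_deriv j (character \<eta>)) \<xi> = \<i> * of_int (\<eta> $ j) * fint (character \<eta>) \<xi>"
    by (simp add: fint_def mult.assoc)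
  from trans[OF this[symmetric] fint_partial_deriv[OF character_smooth_torus]]
  have "(\<i> * of_int (\<eta> $ j) + \<i> * of_int (\<xi> $ j)) * fint (character \<eta>) \<xi> = 0"
    by (simp only: distrib_right mult_minus_left eq_neg_iff_add_eq_0)
  moreover have "\<i> * of_int (\<eta> $ j) + \<i> * of_int (\<xi> $ j) = \<i> * complex_of_int (\<eta> $ j + \<xi> $ j)"
    by (simp add: ring_distribs)
  moreover have "\<eta> $ j + \<xi> $ j \<noteq> 0" using j by simp
  then have "complex_of_int (\<eta> $ j + \<xi> $ j) \<noteq> 0" unfolding of_int_eq_0_iff .
  ultimately show ?thesis using False by (simp only: mult_eq_0_iff complex_i_not_zero if_False) simp
qed

lemma sums_singleI:
  fixes f :: "nat \<Rightarrow> 'a::{comm_monoid_add, t2_space}"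
  assumes "\<And>i. i \<noteq> k \<Longrightarrow> f i = 0"
  shows "f sums f k"
proof -
  have "(\<lambda>i. if i = k then f i else 0) = f" using assms by auto
  then show ?thesis using sums_single[of k f] by simp
qed

lemma fint_series:
  fixes a :: "int ^ 'n::finite \<Rightarrow> complex"
  assumes "rapid a"
  shows "fint (series a) \<xi> = complex_of_real ((2 * pi) ^ CARD('n)) * a (- \<xi>)"
proof -
  let ?t = "\<lambda>i. a (freq_enum i) * fint (character \<xi>) (freq_enum i)"
  obtain k where k: "freq_enum k = - \<xi>" using freq_enum_surj by blast
  have "?t sums ?t k"
    by (rule sums_singleI) (use k in \<open>auto simp: fint_character simp flip: k\<close>)
  moreover have "?t sums fint (series a) \<xi>"
    unfolding fint_def[of "series a"] by (rule series_integral_sums[OF assms character_continuous])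
  ultimately have "fint (series a) \<xi> = ?t k" by (rule sums_unique2[symmetric])
  then show ?thesis by (simp add: k fint_character mult.commute)
qed

section \<open>Completeness of the characters\<close>

lemma periodic_multiple:
  fixes f :: "real ^ 'n::finite \<Rightarrow> complex"
  assumes per: "\<And>j x. f (x + axis j (2 * pi)) = f x"
  shows "f (x + axis j (2 * pi * of_int k)) = f x"
proof (induction k rule: int_induct[where k = 0])
  case base
  then show ?case by (simp add: zero_vec_def[symmetric] axis_def)
next
  case (step1 k)
  have "x + axis j (2 * pi * of_int (k + 1)) = (x + axis j (2 * pi * of_int k)) + axis j (2 * pi)"
    by (simp add: vec_eq_iff axis_def ring_distribs)
  then show ?case by (simp only: per step1.IH)
next
  case (step2 k)
  have "x + axis j (2 * pi * of_int k) = (x + axis j (2 * pi * of_int (k - 1))) + axis j (2 * pi)"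
    by (simp add: vec_eq_iff axis_def ring_distribs)
  then have "f (x + axis j (2 * pi * of_int k)) = f (x + axis j (2 * pi * of_int (k - 1)))"
    by (simp only: per)
  then show ?case using step2.IH by simp
qed

lemma periodic_reduce_to_cell:
  fixes f :: "real ^ 'n::finite \<Rightarrow> complex"
  assumes per: "\<And>j x. f (x + axis j (2 * pi)) = f x"
  obtains y where "y \<in> cell" "f y = f x"
proof -
  define k where "k = (\<lambda>j. - \<lfloor>x $ j / (2 * pi)\<rfloor>)"
  have "f (x + (\<Sum>j\<in>J. axis j (2 * pi * of_int (k j)))) = f x" if "finite J" for J
    using that
  proof induction
    case (insert j J)
    have "x + (\<Sum>j\<in>insert j J. axis j (2 * pi * of_int (k j)))
        = (x + (\<Sum>j\<in>J. axis j (2 * pi * of_int (k j)))) + axis j (2 * pi * of_int (k j))"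
      using insert by (simp add: add_ac)
    then show ?case by (simp only: periodic_multiple[of f, OF per] insert.IH)
  qed simp
  then have eq: "f (x + (\<Sum>j\<in>UNIV. axis j (2 * pi * of_int (k j)))) = f x" by simp
  have "(x + (\<Sum>j\<in>UNIV. axis j (2 * pi * of_int (k j)))) $ i = 2 * pi * frac (x $ i / (2 * pi))" for i
    by (simp add: axis_def k_def frac_def field_simps)
  moreover have "0 \<le> 2 * pi * frac (x $ i / (2 * pi)) \<and> 2 * pi * frac (x $ i / (2 * pi)) \<le> 2 * pi" for i
    using frac_ge_0[of "x $ i / (2 * pi)"] frac_lt_1[of "x $ i / (2 * pi)"] pi_gt_zero
    by (auto intro!: mult_left_le)
  ultimately have "x + (\<Sum>j\<in>UNIV. axis j (2 * pi * of_int (k j))) \<in> cell"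
    by (simp add: mem_box_cart)
  then show ?thesis using eq that by blast
qed

lemma fint_lincomb:
  assumes "continuous_on UNIV f" "continuous_on UNIV g"
  shows "fint (\<lambda>x. a * f x + b * g x) \<xi> = a * fint f \<xi> + b * fint g \<xi>"
proof -
  have "((\<lambda>x. a * (f x * character \<xi> x) + b * (g x * character \<xi> x)) has_integral a * fint f \<xi> + b * fint g \<xi>) cell"
    unfolding fint_def
    by (intro has_integral_add has_integral_mult_right integrable_integral
        integrable_mult_character assms)
  moreover have "(\<lambda>x. a * (f x * character \<xi> x) + b * (g x * character \<xi> x))
      = (\<lambda>x. (a * f x + b * g x) * character \<xi> x)"
    by (simp add: fun_eq_iff ring_distribs mult_ac)
  ultimately show ?thesis unfolding fint_def[of "\<lambda>x. a * f x + b * g x"] by (simp add: integral_unique)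
qed

text \<open>Demanding the vanishing at every frequency makes the class of such \<open>P\<close>
  closed under multiplication by characters, which merely shifts \<open>\<xi>\<close>. Once the
  constant 1 belongs to it, so do all trigonometric polynomials.\<close>

definition annihilated :: "(real ^ 'n::finite \<Rightarrow> complex) \<Rightarrow> (real ^ 'n \<Rightarrow> complex) \<Rightarrow> bool" where
  "annihilated f P \<longleftrightarrow> continuous_on UNIV P \<and> (\<forall>\<xi>. fint (\<lambda>x. f x * P x) \<xi> = 0)"

lemma annihilated_lincomb:
  assumes "continuous_on UNIV f" "annihilated f P" "annihilated f Q"
  shows "annihilated f (\<lambda>x. a * P x + b * Q x)"
proof -
  have c: "continuous_on UNIV P" "continuous_on UNIV Q" using assms by (auto simp: annihilated_def)
  have "(\<lambda>x. f x * (a * P x + b * Q x)) = (\<lambda>x. a * (f x * P x) + b * (f x * Q x))"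
    by (simp add: fun_eq_iff ring_distribs mult_ac)
  moreover have "fint (\<lambda>x. a * (f x * P x) + b * (f x * Q x)) \<xi> = 0" for \<xi>
    using assms by (subst fint_lincomb) (auto simp: annihilated_def intro!: continuous_on_mult)
  ultimately show ?thesis
    unfolding annihilated_def by (auto intro!: continuous_intros c)
qed

lemma annihilated_character:
  assumes "annihilated f P"
  shows "annihilated f (\<lambda>x. P x * character \<eta> x)"
proof -
  have "fint (\<lambda>x. f x * (P x * character \<eta> x)) \<xi> = fint (\<lambda>x. f x * P x) (\<eta> + \<xi>)" for \<xi>
    by (simp add: fint_def mult.assoc character_mult)
  then show ?thesis
    using assms by (auto simp: annihilated_def intro!: continuous_on_mult character_continuous)
qed

lemma raised_cosine_eq_characters:
  "complex_of_real ((1 + cos (x $ j - t)) / 2)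
    = 1 / 2 * 1 + (exp (- \<i> * t) / 4 * character (axis j 1) x + exp (\<i> * t) / 4 * character (- axis j 1) x)"
proof -
  have freq: "freq (axis j 1) = (axis j 1 :: real ^ 'a)" "freq (- axis j 1) = (- axis j 1 :: real ^ 'a)"
    by (auto simp: freq_def vec_eq_iff axis_def)
  have e: "character (axis j 1) x = exp (\<i> * (x $ j))" "character (- axis j 1) x = exp (- \<i> * (x $ j))"
    by (simp_all add: character_def freq inner_axis)
  have "complex_of_real (cos (x $ j - t)) = (exp (\<i> * (x $ j - t)) + exp (- \<i> * (x $ j - t))) / 2"
    unfolding cos_of_real[symmetric] cos_exp_eq by simp
  also have "\<dots> = (exp (- \<i> * t) * exp (\<i> * (x $ j)) + exp (\<i> * t) * exp (- \<i> * (x $ j))) / 2"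
    by (simp add: exp_add[symmetric] ring_distribs)
  finally have cos: "complex_of_real (cos (x $ j - t)) = \<dots>" .
  have "complex_of_real ((1 + cos (x $ j - t)) / 2) = (1 + complex_of_real (cos (x $ j - t))) / 2" by simp
  also have "\<dots> = (1 + (exp (- \<i> * t) * exp (\<i> * (x $ j)) + exp (\<i> * t) * exp (- \<i> * (x $ j))) / 2) / 2"
    by (simp only: cos)
  finally show ?thesis by (simp add: e add_divide_distrib)
qed

lemma annihilated_raised_cosine:
  assumes "continuous_on UNIV f" "annihilated f P"
  shows "annihilated f (\<lambda>x. P x * complex_of_real ((1 + cos (x $ j - t)) / 2))"
proof -
  have "annihilated f (\<lambda>x. 1 / 2 * P x + 1 * (exp (- \<i> * t) / 4 * (P x * character (axis j 1) x)
      + exp (\<i> * t) / 4 * (P x * character (- axis j 1) x)))"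
    by (intro annihilated_lincomb annihilated_character assms)
  moreover have "(\<lambda>x. P x * complex_of_real ((1 + cos (x $ j - t)) / 2))
      = (\<lambda>x. 1 / 2 * P x + 1 * (exp (- \<i> * t) / 4 * (P x * character (axis j 1) x)
      + exp (\<i> * t) / 4 * (P x * character (- axis j 1) x)))"
    unfolding raised_cosine_eq_characters by (simp add: fun_eq_iff ring_distribs mult_ac)
  ultimately show ?thesis by simp
qed

text \<open>The peak function: a trigonometric polynomial with values in \<open>[0, 1]\<close> that
  equals 1 only at \<open>c\<close> and its translates by periods.\<close>

definition bump :: "real ^ 'n::finite \<Rightarrow> real ^ 'n \<Rightarrow> real" where
  "bump c x = (\<Prod>j\<in>UNIV. (1 + cos (x $ j - c $ j)) / 2)"

lemma annihilated_bump:
  assumes "continuous_on UNIV f" "annihilated f P"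
  shows "annihilated f (\<lambda>x. P x * complex_of_real (bump c x))"
proof -
  have "annihilated f (\<lambda>x. P x * (\<Prod>j\<in>J. complex_of_real ((1 + cos (x $ j - c $ j)) / 2)))" if "finite J" for J
    using that
  proof induction
    case (insert j J)
    have "annihilated f (\<lambda>x. P x * (\<Prod>j\<in>J. complex_of_real ((1 + cos (x $ j - c $ j)) / 2))
        * complex_of_real ((1 + cos (x $ j - c $ j)) / 2))"
      by (rule annihilated_raised_cosine[OF assms(1) insert.IH])
    then show ?case using insert by (simp add: mult_ac)
  qed (simp add: assms)
  then show ?thesis by (simp add: bump_def)
qed

lemma annihilated_bump_power:
  assumes "continuous_on UNIV f" "\<And>\<xi>. fint f \<xi> = 0"
  shows "annihilated f (\<lambda>x. complex_of_real ((bump c x + e) ^ N))"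
proof (induction N)
  case 0
  then show ?case using assms by (simp add: annihilated_def)
next
  case (Suc N)
  have "annihilated f (\<lambda>x. 1 * (complex_of_real ((bump c x + e) ^ N) * complex_of_real (bump c x))
      + complex_of_real e * complex_of_real ((bump c x + e) ^ N))"
    by (intro annihilated_lincomb annihilated_bump assms Suc)
  moreover have "(\<lambda>x. complex_of_real ((bump c x + e) ^ Suc N))
      = (\<lambda>x. 1 * (complex_of_real ((bump c x + e) ^ N) * complex_of_real (bump c x))
      + complex_of_real e * complex_of_real ((bump c x + e) ^ N))"
    by (simp add: fun_eq_iff ring_distribs mult_ac)
  ultimately show ?case by simp
qed

lemma bump_nonneg: "0 \<le> bump c x"
proof -
  have "0 \<le> 1 + cos (x $ j - c $ j)" for j using cos_ge_minus_one[of "x $ j - c $ j"] by linarith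
  then show ?thesis unfolding bump_def by (intro prod_nonneg) simp
qed

lemma bump_le_1: "bump c x \<le> 1"
proof -
  have "0 \<le> 1 + cos (x $ j - c $ j)" for j using cos_ge_minus_one[of "x $ j - c $ j"] by linarith
  then show ?thesis unfolding bump_def by (intro prod_le_1) simp
qed

lemma bump_center: "bump c c = 1"
  by (simp add: bump_def)

lemma bump_continuous: "continuous_on S (bump c)"
  unfolding bump_def[abs_def] by (intro continuous_intros) auto

text \<open>Since \<open>c\<close> is interior, each \<open>x $ j - c $ j\<close> lies strictly
  between \<open>- 2 pi\<close> and \<open>2 pi\<close>, so the only period available is 0. For
  \<open>c\<close> on the boundary the opposite face would give a second peak.\<close>

lemma bump_less_1:
  fixes c x :: "real ^ 'n::finite"
  assumes c: "c \<in> box 0 (\<chi> j. 2 * pi)" and x: "x \<in> cell" and "x \<noteq> c"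
  shows "bump c x < 1"
proof -
  have "bump c x \<noteq> 1"
  proof
    assume eq: "bump c x = 1"
    obtain j where j: "x $ j \<noteq> c $ j" using \<open>x \<noteq> c\<close> by (auto simp: vec_eq_iff)
    have nn: "0 \<le> (1 + cos (x $ i - c $ i)) / 2" for i
    proof -
      have "0 \<le> 1 + cos (x $ i - c $ i)" using cos_ge_minus_one[of "x $ i - c $ i"] by linarith
      then show ?thesis by (rule divide_nonneg_pos) simp
    qed
    have "bump c x = (1 + cos (x $ j - c $ j)) / 2 * (\<Prod>i\<in>UNIV - {j}. (1 + cos (x $ i - c $ i)) / 2)"
      unfolding bump_def by (rule prod.remove) auto
    also have "\<dots> \<le> (1 + cos (x $ j - c $ j)) / 2"
      using nn by (intro mult_left_le prod_le_1) auto
    finally have "cos (x $ j - c $ j) = 1" using eq cos_le_one[of "x $ j - c $ j"] by simp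
    then obtain n :: int where n: "x $ j - c $ j = of_int n * 2 * pi"
      unfolding cos_one_2pi_int by blast
    have "- (2 * pi) < x $ j - c $ j" "x $ j - c $ j < 2 * pi"
      using c x by (auto simp: mem_box_cart) (smt (verit))+
    then have "- 1 * (2 * pi) < of_int n * (2 * pi)" "of_int n * (2 * pi) < 1 * (2 * pi)" using n by auto
    then have "- 1 < real_of_int n" "real_of_int n < 1"
      unfolding mult_less_cancel_right_pos[OF mult_pos_pos[OF zero_less_numeral pi_gt_zero]] by auto
    then have "n = 0" by linarith
    then show False using n j by simp
  qed
  then show ?thesis using bump_le_1[of c x] by simp
qed

text \<open>If \<open>h c > 0\<close>, then for small \<open>e > 0\<close> the powers of \<open>bump c + e\<close> blow up near \<open>c\<close> and
  stay bounded wherever \<open>h\<close> is not positive, so the integrals would tend to infinity.\<close>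

lemma no_peak_integral:
  fixes h :: "real ^ 'n::finite \<Rightarrow> real"
  assumes h: "continuous_on UNIV h" and c: "c \<in> box 0 (\<chi> j. 2 * pi)"
    and zero: "\<And>e N. integral cell (\<lambda>x. h x * (bump c x + e) ^ N) = 0"
  shows "h c \<le> 0"
proof (rule ccontr)
  assume "\<not> h c \<le> 0"
  define d where "d = h c / 2"
  have d: "d > 0" "d < h c" using \<open>\<not> h c \<le> 0\<close> by (auto simp: d_def)
  define V where "V = {x. d < h x}"
  have V: "open V" "c \<in> V"
    using h d unfolding V_def by (auto intro: open_Collect_less continuous_on_const)
  have "\<exists>M<1. \<forall>x\<in>cell - V. bump c x \<le> M"
  proof (cases "cell - V = {}")
    case True
    then show ?thesis by (intro exI[of _ 0]) auto
  next
    case False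
    have "compact (cell - V)" by (rule compact_diff[OF compact_cbox V(1)])
    from continuous_attains_sup[OF this False bump_continuous]
    obtain y where y: "y \<in> cell - V" "\<forall>x\<in>cell - V. bump c x \<le> bump c y" by blast
    then have "bump c y < 1" using V(2) by (intro bump_less_1[OF c]) auto
    then show ?thesis using y by blast
  qed
  then obtain M where M: "M < 1" "\<And>x. x \<in> cell - V \<Longrightarrow> bump c x \<le> M" by blast
  \<comment> \<open>The shift \<open>e\<close> keeps \<open>bump c + e\<close> at most
    \<open>M + e \<le> 1\<close> on the part of the cell outside \<open>V\<close>, while the value
    \<open>1 + e\<close> at the peak leaves room for a threshold \<open>s\<close> strictly between 1
    and \<open>1 + e\<close>.\<close>
  define e where "e = (1 - M) / 2"
  define s where "s = 1 + e / 2"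
  have e: "e > 0" "M + e \<le> 1" "s > 1" "s < 1 + e" using M(1) by (auto simp: e_def s_def field_simps)
  define Q where "Q = (\<lambda>x. bump c x + e)"
  have Q: "continuous_on S Q" for S
    unfolding Q_def by (intro continuous_intros bump_continuous)
  have Q0: "0 \<le> Q x" for x using bump_nonneg[of c x] e(1) by (simp add: Q_def)
  define U where "U = V \<inter> {x. s < Q x} \<inter> box 0 (\<chi> j. 2 * pi)"
  have "open U"
    unfolding U_def by (intro open_Int V(1) open_Collect_less continuous_on_const Q open_box)
  moreover have "c \<in> U" using V(2) c e(4) by (simp add: U_def Q_def bump_center)
  ultimately obtain a b where ab: "cbox a b \<subseteq> U" "c \<in> box a b"
    by (meson open_contains_cbox)
  have "box a b \<noteq> {}" using ab(2) by auto
  then have vol: "measure lborel (cbox a b) > 0" by (simp add: content_pos_lt_eq box_ne_empty)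
  have sub: "cbox a b \<subseteq> cell"
    using ab(1) box_subset_cbox unfolding U_def by blast
  obtain H where H: "\<And>x. x \<in> cell \<Longrightarrow> \<bar>h x\<bar> \<le> H"
  proof -
    have "compact (h ` cell)"
      by (intro compact_continuous_image continuous_on_subset[OF h subset_UNIV] compact_cbox)
    from compact_imp_bounded[OF this] show ?thesis using that unfolding bounded_iff by auto
  qed
  have int: "(\<lambda>x. h x * Q x ^ N + H) integrable_on cbox a' b'" for N a' b'
    by (intro integrable_continuous continuous_intros continuous_on_subset[OF h subset_UNIV] Q)
  \<comment> \<open>Adding the bound \<open>H\<close> of the modulus of \<open>h\<close> makes the
    integrand nonnegative on the whole cell, so its integral over the small box around
    \<open>c\<close> is at most the one over the cell. The latter stays constant in
    \<open>N\<close>, whereas the former grows at least like \<open>s ^ N\<close>.\<close>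
  have lower: "0 \<le> h x * Q x ^ N + H" if x: "x \<in> cell" for x N
  proof (cases "x \<in> V")
    case True
    then have "0 \<le> h x * Q x ^ N" using d(1) Q0[of x] by (simp add: V_def)
    then show ?thesis using H[OF x] by linarith
  next
    case False
    then have "Q x \<le> 1" using M(2)[of x] x e(2) by (simp add: Q_def)
    then have "Q x ^ N \<le> 1" using Q0[of x] by (intro power_le_one)
    then have "\<bar>h x * Q x ^ N\<bar> \<le> \<bar>h x\<bar>" using Q0[of x] by (simp add: abs_mult mult_left_le)
    then show ?thesis using H[OF x] by linarith
  qed
  have bound: "d * s ^ N * measure lborel (cbox a b) \<le> H * measure lborel (cell :: (real ^ 'n) set)" for N
  proof -
    have "d * s ^ N * measure lborel (cbox a b) = integral (cbox a b) (\<lambda>x. d * s ^ N)"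
      by (simp add: mult.commute)
    also have "\<dots> \<le> integral (cbox a b) (\<lambda>x. h x * Q x ^ N + H)"
    proof (rule integral_le[OF integrable_const int])
      fix x assume "x \<in> cbox a b"
      then have x: "d < h x" "s < Q x" "x \<in> cell" using ab(1) sub by (auto simp: U_def V_def)
      have "d * s ^ N \<le> h x * Q x ^ N"
        using x d(1) e(3) by (intro mult_mono power_mono) auto
      then show "d * s ^ N \<le> h x * Q x ^ N + H" using H[OF x(3)] by linarith
    qed
    also have "\<dots> \<le> integral cell (\<lambda>x. h x * Q x ^ N + H)"
      by (rule integral_subset_le[OF sub int int]) (use lower in blast)
    also have "\<dots> = integral cell (\<lambda>x. h x * Q x ^ N) + integral cell (\<lambda>x :: real ^ 'n. H)"
      by (intro integral_add integrable_const integrable_continuous continuous_intros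
          continuous_on_subset[OF h subset_UNIV] Q)
    also have "\<dots> = H * measure lborel (cell :: (real ^ 'n) set)"
      using zero[of e N] by (simp add: Q_def mult.commute)
    finally show ?thesis .
  qed
  let ?A = "d * measure lborel (cbox a b)"
  have A: "?A > 0" using d(1) vol by simp
  obtain N where "H * measure lborel (cell :: (real ^ 'n) set) / ?A < s ^ N"
    using real_arch_pow[OF e(3)] by blast
  then have "H * measure lborel (cell :: (real ^ 'n) set) < s ^ N * ?A"
    using A by (simp only: pos_divide_less_eq)
  then show False using bound[of N] by (simp add: mult_ac)
qed

lemma fint_zero_imp_zero:
  fixes f :: "real ^ 'n::finite \<Rightarrow> complex"
  assumes f: "continuous_on UNIV f" and per: "\<And>j x. f (x + axis j (2 * pi)) = f x"
    and zero: "\<And>\<xi>. fint f \<xi> = 0"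
  shows "f x = 0"
proof -
  have interior: "f c = 0" if c: "c \<in> box 0 (\<chi> j. 2 * pi)" for c
  proof -
    \<comment> \<open>Rotating the values by \<open>cnj (f c)\<close> turns the value at
      \<open>c\<close> into the squared modulus, so the nonpositivity of \<open>h c\<close> forces
      \<open>f c = 0\<close>.\<close>
    define h where "h = (\<lambda>x. Re (cnj (f c) * f x))"
    have "h c \<le> 0"
    proof (rule no_peak_integral[OF _ c])
      show "continuous_on UNIV h" unfolding h_def by (intro continuous_intros f)
      fix e N
      let ?P = "\<lambda>x. complex_of_real ((bump c x + e) ^ N)"
      have P: "annihilated f ?P" by (rule annihilated_bump_power[OF f zero])
      have cont: "continuous_on UNIV (\<lambda>x. f x * ?P x)"
        using P f by (auto simp: annihilated_def intro!: continuous_on_mult)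
      have "((\<lambda>x. f x * ?P x) has_integral fint (\<lambda>x. f x * ?P x) 0) cell"
        using integrable_integral[OF integrable_mult_character[OF cont, of 0]] by (simp add: fint_def)
      then have "((\<lambda>x. f x * ?P x) has_integral 0) cell" using P by (simp add: annihilated_def)
      then have "((\<lambda>x. cnj (f c) * (f x * ?P x)) has_integral cnj (f c) * 0) cell"
        by (rule has_integral_mult_right)
      from has_integral_linear[OF this bounded_linear_Re]
      have "((\<lambda>x. h x * (bump c x + e) ^ N) has_integral 0) cell"
        by (simp add: o_def h_def mult.assoc[symmetric] del: of_real_power)
      then show "integral cell (\<lambda>x. h x * (bump c x + e) ^ N) = 0" by (rule integral_unique)
    qed
    moreover have "h c = (cmod (f c))\<^sup>2"
      unfolding h_def cmod_power2 by (simp add: power2_eq_square)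
    ultimately show "f c = 0" by simp
  qed
  \<comment> \<open>The peak argument covers interior points only: continuity extends the result to
    the closed cell, and periodicity to the whole space.\<close>
  obtain y where y: "y \<in> cell" "f y = f x" using periodic_reduce_to_cell[of f, OF per] by blast
  have "box 0 (\<chi> j. 2 * pi) \<noteq> ({} :: (real ^ 'n) set)" by (simp add: interval_ne_empty_cart)
  then have "y \<in> closure (box 0 (\<chi> j. 2 * pi))" using y(1) by (simp add: closure_box)
  then have "f y = 0"
    using continuous_constant_on_closure[OF continuous_on_subset[OF f subset_UNIV] interior] by blast
  then show ?thesis using y(2) by simp
qed

text \<open>The series built from the coefficients of \<open>f\<close> has the same Fourier
  integrals as \<open>f\<close>, so completeness applies to the difference.\<close>

lemma smooth_torus_eq_series:
  fixes f :: "real ^ 'n::finite \<Rightarrow> complex"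
  assumes f: "f \<in> smooth_torus"
  defines "a \<equiv> \<lambda>\<xi>. fint f (- \<xi>) / complex_of_real ((2 * pi) ^ CARD('n))"
  shows "rapid a" "f = series a"
proof -
  have "rapid (\<lambda>\<xi>. fint f (- \<xi>))"
    using rapid_fint[OF f] unfolding rapid_def by (metis wt_minus)
  moreover have "tempered (\<lambda>_. 1 / complex_of_real ((2 * pi) ^ CARD('n)) :: complex)"
    unfolding tempered_def by (rule exI[of _ 0]) auto
  ultimately have "rapid (\<lambda>\<xi> :: int ^ 'n. 1 / complex_of_real ((2 * pi) ^ CARD('n)) * fint f (- \<xi>))"
    by (rule rapid_mult_tempered)
  then show a: "rapid a" by (simp add: a_def)
  have s: "series a \<in> smooth_torus" by (rule series_smooth_torus[OF a])
  note cont = smooth_torus_continuous_on[where js = "[]", simplified]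
  let ?g = "\<lambda>x. 1 * f x + (- 1) * series a x"
  have "?g x = 0" for x
  proof (rule fint_zero_imp_zero)
    show "continuous_on UNIV ?g" by (intro continuous_intros cont f s)
    show "?g (x + axis j (2 * pi)) = ?g x" for j x
      using smooth_torus_periodic[OF f] smooth_torus_periodic[OF s] by simp
    have "complex_of_real ((2 * pi) ^ CARD('n)) \<noteq> 0" by simp
    then show "fint ?g \<xi> = 0" for \<xi>
      unfolding fint_lincomb[OF cont[OF f] cont[OF s]] fint_series[OF a] by (simp add: a_def del: of_real_power)
  qed
  then show "f = series a" by (simp add: fun_eq_iff)
qed

section \<open>Fourier coefficients of distributions\<close>

lemma distribution_lincomb:
  assumes "u \<in> distributions" "f \<in> smooth_torus" "g \<in> smooth_torus"
  shows "u (\<lambda>x. a * f x + b * g x) = a * u f + b * u g"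
  using assms unfolding distributions_def by blast

lemma distribution_tendsto:
  assumes "u \<in> distributions" "\<And>i. F i \<in> smooth_torus" "f \<in> smooth_torus"
    "\<And>js. uniform_limit UNIV (\<lambda>i. partial_derivs js (F i)) (partial_derivs js f) sequentially"
  shows "(\<lambda>i. u (F i)) \<longlonglongrightarrow> u f"
  using assms unfolding distributions_def by blast

lemma norm_deriv_symbol_le:
  "cmod (\<Prod>j\<leftarrow>js. \<i> * of_int (\<xi> $ j)) \<le> wt \<xi> ^ length js"
proof (induction js)
  case (Cons j js)
  then show ?case
    using abs_coord_le_wt[of \<xi> j] wt_pos[of \<xi>] by (auto simp: norm_mult intro!: mult_mono)
qed simp

text \<open>Otherwise suitably scaled characters would tend to \<open>0\<close> with all derivatives while \<open>u\<close>
  takes the value \<open>1\<close> on each of them.\<close>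

lemma distribution_tempered:
  fixes u :: "'n::finite functional"
  assumes u: "u \<in> distributions"
  shows "tempered (fourier_coeff u)"
proof (rule ccontr)
  assume "\<not> tempered (fourier_coeff u)"
  then have "\<exists>\<xi>. real (Suc N) * wt \<xi> ^ N < cmod (fourier_coeff u \<xi>)" for N
    unfolding tempered_def not_ex not_all not_le by blast
  then obtain g where g: "\<And>N. real (Suc N) * wt (g N) ^ N < cmod (fourier_coeff u (g N))" by metis
  define c where "c = (\<lambda>N. u (character (- g N)))"
  have c: "real (Suc N) * wt (g N) ^ N < cmod (c N)" for N
  proof -
    have V: "1 \<le> (2 * pi) ^ CARD('n)" using pi_ge_two by (intro one_le_power) simp
    have "cmod (fourier_coeff u (g N)) = cmod (c N) / (2 * pi) ^ CARD('n)"
      by (simp add: fourier_coeff_def c_def norm_divide norm_mult norm_power)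
    also have "\<dots> \<le> cmod (c N) / 1" by (rule divide_left_mono) (use V in auto)
    finally show ?thesis using g[of N] by simp
  qed
  have c0: "c N \<noteq> 0" for N
  proof -
    have "0 \<le> real (Suc N) * wt (g N) ^ N" using wt_pos[of "g N"] by simp
    then show ?thesis using c[of N] by auto
  qed
  \<comment> \<open>Characters scaled so that \<open>u\<close> maps each to 1. The zero summand only
    gives them the shape of a linear combination, for which derivatives and values of
    \<open>u\<close> are known.\<close>
  define F where "F = (\<lambda>N x. 1 / c N * character (- g N) x + 0 * character 0 x)"
  define z :: "real ^ 'n \<Rightarrow> complex" where "z = (\<lambda>x. 0 * character 0 x + 0 * character 0 x)"
  have dF: "partial_derivs js (F N) x = 1 / c N * ((\<Prod>j\<leftarrow>js. \<i> * of_int ((- g N) $ j)) * character (- g N) x)"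
    for js N x
    unfolding F_def by (subst partial_derivs_lincomb) (auto simp: partial_derivs_character)
  have dz: "partial_derivs js z x = 0" for js x
    unfolding z_def by (subst partial_derivs_lincomb) auto
  have "(\<lambda>N. u (F N)) \<longlonglongrightarrow> u z"
  proof (rule distribution_tendsto[OF u])
    show "F N \<in> smooth_torus" for N unfolding F_def by (rule smooth_torus_lincomb) (rule character_smooth_torus)+
    show "z \<in> smooth_torus" unfolding z_def by (rule smooth_torus_lincomb) (rule character_smooth_torus)+
    fix js :: "'n list"
    \<comment> \<open>Once \<open>N\<close> reaches the order of the derivative, differentiation
      costs at most \<open>wt (g N) ^ N\<close>. The lower bound on \<open>c N\<close> pays for this
      and leaves the factor \<open>1 / (N + 1)\<close>.\<close>
    have bound: "cmod (partial_derivs js (F N) x) \<le> 1 / real (Suc N)" if "length js \<le> N" for N x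
    proof -
      have "cmod (partial_derivs js (F N) x) = cmod (\<Prod>j\<leftarrow>js. \<i> * of_int ((- g N) $ j)) / cmod (c N)"
        unfolding dF by (simp only: norm_mult norm_divide norm_one norm_character) simp
      also have "\<dots> \<le> wt (g N) ^ N / (real (Suc N) * wt (g N) ^ N)"
      proof (rule frac_le)
        show "cmod (\<Prod>j\<leftarrow>js. \<i> * of_int ((- g N) $ j)) \<le> wt (g N) ^ N"
          using norm_deriv_symbol_le[of "- g N" js] wt_power_mono[OF that, of "g N"] by simp
        show "0 < real (Suc N) * wt (g N) ^ N" using wt_pos[of "g N"] by simp
      qed (use c[of N] wt_pos[of "g N"] in \<open>auto intro: less_imp_le\<close>)
      also have "\<dots> = 1 / real (Suc N)" using wt_pos[of "g N"] by (simp del: of_nat_Suc)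
      finally show ?thesis .
    qed
    show "uniform_limit UNIV (\<lambda>i. partial_derivs js (F i)) (partial_derivs js z) sequentially"
    proof (rule uniform_limitI)
      fix e :: real assume "e > 0"
      have "\<forall>\<^sub>F N in sequentially. 1 / real (Suc N) < e"
        using order_tendstoD(2)[OF LIMSEQ_inverse_real_of_nat \<open>e > 0\<close>] by (simp add: inverse_eq_divide)
      moreover have "\<forall>\<^sub>F N in sequentially. length js \<le> N" by (rule eventually_ge_at_top)
      ultimately show "\<forall>\<^sub>F N in sequentially. \<forall>x\<in>UNIV. dist (partial_derivs js (F N) x) (partial_derivs js z x) < e"
      proof eventually_elim
        case (elim N)
        then show ?case using le_less_trans[OF bound[of N]] by (auto simp: dz dist_norm)
      qed
    qed
  qed
  moreover have "u (F N) = 1" for N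
    unfolding F_def by (subst distribution_lincomb[OF u]) (use c0 in \<open>auto simp: c_def\<close>)
  moreover have "u z = 0"
    unfolding z_def by (subst distribution_lincomb[OF u]) auto
  ultimately show False using LIMSEQ_const_iff[of "1 :: complex" 0] by simp
qed

lemma distribution_character:
  fixes u :: "'n::finite functional"
  shows "u (character \<xi>) = complex_of_real ((2 * pi) ^ CARD('n)) * fourier_coeff u (- \<xi>)"
  by (simp add: fourier_coeff_def)

text \<open>The truncated Fourier series of \<open>f\<close> converge to \<open>f\<close> with all
  derivatives, so linearity and continuity of \<open>u\<close> determine \<open>u f\<close> by the
  coefficients of \<open>u\<close>. The reflected index comes from the opposite signs in
  \<open>fint\<close> and \<open>fourier_coeff\<close>.\<close>

lemma distribution_sums:
  fixes u :: "'n::finite functional"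
  assumes u: "u \<in> distributions" and f: "f \<in> smooth_torus"
  shows "(\<lambda>i. fint f (- freq_enum i) * fourier_coeff u (- freq_enum i)) sums u f"
proof -
  define V where "V = complex_of_real ((2 * pi) ^ CARD('n))"
  have V: "V \<noteq> 0" by (simp add: V_def)
  define a where "a = (\<lambda>\<xi>. fint f (- \<xi>) / V)"
  have a: "rapid a" and fa: "f = series a"
    using smooth_torus_eq_series[OF f] by (simp_all add: a_def V_def)
  have "u (series (truncate N a)) = (\<Sum>i<N. a (freq_enum i) * u (character (freq_enum i)))" for N
  proof (induction N)
    case 0
    have "series (truncate 0 a) = (\<lambda>x. 0 * character 0 x + 0 * character 0 x)"
      by (auto simp: series_truncate)
    then show ?case using distribution_lincomb[OF u, of "character 0" "character 0" 0 0] by simp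
  next
    case (Suc N)
    have "series (truncate (Suc N) a)
        = (\<lambda>x. 1 * series (truncate N a) x + a (freq_enum N) * character (freq_enum N) x)"
      by (auto simp: series_truncate)
    moreover have "u (\<lambda>x. 1 * series (truncate N a) x + a (freq_enum N) * character (freq_enum N) x)
        = 1 * u (series (truncate N a)) + a (freq_enum N) * u (character (freq_enum N))"
      by (intro distribution_lincomb[OF u] series_smooth_torus rapid_truncate a character_smooth_torus)
    ultimately show ?case using Suc by simp
  qed
  moreover have "(\<lambda>N. u (series (truncate N a))) \<longlonglongrightarrow> u (series a)"
    by (intro distribution_tendsto[OF u] series_smooth_torus rapid_truncate a partial_derivs_series_uniform_limit)
  ultimately have "(\<lambda>i. a (freq_enum i) * u (character (freq_enum i))) sums u f"
    by (simp add: sums_def fa[symmetric])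
  moreover have "a \<xi> * u (character \<xi>) = fint f (- \<xi>) * fourier_coeff u (- \<xi>)" for \<xi>
    unfolding distribution_character V_def[symmetric] a_def using V by simp
  ultimately show ?thesis by simp
qed

lemma distribution_eqI:
  fixes u v :: "'n::finite functional"
  assumes u: "u \<in> distributions" and v: "v \<in> distributions" and "fourier_coeff u = fourier_coeff v"
  shows "u = v"
proof (rule extensionalityI)
  show "u \<in> extensional smooth_torus" "v \<in> extensional smooth_torus"
    using u v by (auto simp: distributions_def)
  show "u f = v f" if "f \<in> smooth_torus" for f
    using distribution_sums[OF u that] distribution_sums[OF v that] unfolding assms(3) by (rule sums_unique2)
qed

lemma summable_pairing:
  fixes a :: "int ^ 'n::finite \<Rightarrow> complex" and f :: "real ^ 'n \<Rightarrow> complex"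
  assumes "tempered a" "f \<in> smooth_torus"
  shows "summable (\<lambda>i. a (freq_enum i) * fint f (freq_enum i))"
  by (rule summable_norm_cancel, rule rapid_summable_enum[OF rapid_mult_tempered[OF rapid_fint assms(1)]])
    (rule assms(2))

text \<open>Fourier decay of order \<open>N + CARD('n)\<close> is spent in two portions:
  \<open>N\<close> absorbs the growth of \<open>a\<close>, and \<open>CARD('n)\<close> leaves a
  summable weight. The functional therefore has finite order, at most
  \<open>2 * (N + CARD('n))\<close>.\<close>

lemma pairing_bound:
  fixes a :: "int ^ 'n::finite \<Rightarrow> complex"
  assumes a: "tempered a"
  shows "\<exists>K\<ge>0. \<exists>M. \<forall>f\<in>(smooth_torus :: (real ^ 'n \<Rightarrow> complex) set). \<forall>B.
    (\<forall>js x. length js \<le> M \<longrightarrow> x \<in> cell \<longrightarrow> cmod (partial_derivs js f x) \<le> B) \<longrightarrow>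
    cmod (\<Sum>i. a (freq_enum i) * fint f (freq_enum i)) \<le> K * B"
proof -
  obtain N A where A: "A > 0" "\<And>\<xi>. cmod (a \<xi>) \<le> A * wt \<xi> ^ N" by (rule temperedD[OF a]) (rule that)
  obtain C where C: "C \<ge> 0" "\<forall>f\<in>smooth_torus. \<forall>B. (\<forall>js x. length js \<le> 2 * (N + CARD('n)) \<longrightarrow> x \<in> cell
      \<longrightarrow> cmod (partial_derivs js f x) \<le> B) \<longrightarrow> (\<forall>\<xi> :: int ^ 'n. cmod (fint f \<xi>) * wt \<xi> ^ (N + CARD('n)) \<le> C * B)"
    using fint_decay[where 'n = 'n, of "N + CARD('n)"] by blast
  define w where "w = (\<lambda>i. 1 / wt (freq_enum i :: int ^ 'n) ^ CARD('n))"
  have w: "summable w" unfolding w_def by (rule summable_freq_enum[OF summable_on_wt])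
  have w0: "0 \<le> w i" for i using wt_pos[of "freq_enum i :: int ^ 'n"] by (simp add: w_def)
  have "cmod (\<Sum>i. a (freq_enum i) * fint f (freq_enum i)) \<le> A * C * suminf w * B"
    if f: "f \<in> smooth_torus"
      and B: "\<forall>js x. length js \<le> 2 * (N + CARD('n)) \<longrightarrow> x \<in> cell \<longrightarrow> cmod (partial_derivs js f x) \<le> B"
    for f :: "real ^ 'n \<Rightarrow> complex" and B
  proof -
    have "cmod (a \<xi> * fint f \<xi>) \<le> A * C * B * (1 / wt \<xi> ^ CARD('n))" for \<xi>
    proof -
      have "cmod (fint f \<xi>) * wt \<xi> ^ (N + CARD('n)) \<le> C * B"
        using C(2)[rule_format, OF f] B by blast
      then have "cmod (fint f \<xi>) * wt \<xi> ^ N \<le> C * B * (1 / wt \<xi> ^ CARD('n))"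
        using wt_pos[of \<xi>] by (simp add: power_add pos_le_divide_eq mult.assoc)
      then have "A * (cmod (fint f \<xi>) * wt \<xi> ^ N) \<le> A * (C * B * (1 / wt \<xi> ^ CARD('n)))"
        using A(1) by (intro mult_left_mono) auto
      moreover have "cmod (a \<xi> * fint f \<xi>) \<le> A * wt \<xi> ^ N * cmod (fint f \<xi>)"
        using A(2)[of \<xi>] by (simp add: norm_mult mult_right_mono)
      ultimately show ?thesis by (simp add: mult_ac)
    qed
    then have "cmod (\<Sum>i. a (freq_enum i) * fint f (freq_enum i)) \<le> (\<Sum>i. A * C * B * w i)"
      by (intro norm_suminf_le summable_mult w) (simp add: w_def)
    also have "\<dots> = A * C * suminf w * B" by (simp add: suminf_mult[OF w])
    finally show ?thesis .
  qed
  moreover have "0 \<le> A * C * suminf w" using A C w w0 by (simp add: suminf_nonneg)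
  ultimately show ?thesis by blast
qed

text \<open>Continuity comes from the finite-order bound applied to \<open>F i - f\<close>, since
  only finitely many derivatives must be small. Orthogonality recovers the coefficients.\<close>

lemma tempered_distribution:
  fixes a :: "int ^ 'n::finite \<Rightarrow> complex"
  assumes a: "tempered a"
  shows "\<exists>u\<in>distributions. fourier_coeff u = a \<and>
    (\<forall>f\<in>smooth_torus. u f = (\<Sum>i. a (freq_enum i) * fint f (freq_enum i)))"
proof -
  let ?t = "\<lambda>(f :: real ^ 'n \<Rightarrow> complex) i. a (freq_enum i) * fint f (freq_enum i)"
  define u where "u = restrict (\<lambda>f. \<Sum>i. ?t f i) smooth_torus"
  have u: "u f = (\<Sum>i. ?t f i)" if "f \<in> smooth_torus" for f using that by (simp add: u_def)
  have lin: "u (\<lambda>x. c * f x + d * g x) = c * u f + d * u g"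
    if "f \<in> smooth_torus" "g \<in> smooth_torus" for f g c d
  proof -
    note cont = smooth_torus_continuous_on[where js = "[]", simplified]
    have "?t (\<lambda>x. c * f x + d * g x) i = c * ?t f i + d * ?t g i" for i
      by (simp add: fint_lincomb cont that ring_distribs mult_ac)
    moreover have "(\<lambda>i. c * ?t f i + d * ?t g i) sums (c * u f + d * u g)"
      unfolding u[OF that(1)] u[OF that(2)]
      by (intro sums_add sums_mult summable_sums summable_pairing a that)
    ultimately show ?thesis unfolding u[OF smooth_torus_lincomb[OF that]] by (simp add: sums_iff)
  qed
  obtain K M where K: "K \<ge> 0" "\<forall>f\<in>smooth_torus. \<forall>B. (\<forall>js x. length js \<le> M \<longrightarrow> x \<in> cell
      \<longrightarrow> cmod (partial_derivs js f x) \<le> B) \<longrightarrow> cmod (\<Sum>i. ?t f i) \<le> K * B"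
    using pairing_bound[OF a] by blast
  have lim: "(\<lambda>i. u (F i)) \<longlonglongrightarrow> u f"
    if F: "\<And>i::nat. F i \<in> smooth_torus" and f: "f \<in> smooth_torus"
      and conv: "\<And>js. uniform_limit UNIV (\<lambda>i. partial_derivs js (F i)) (partial_derivs js f) sequentially"
    for F and f :: "real ^ 'n \<Rightarrow> complex"
  proof (rule tendstoI)
    fix e :: real assume "e > 0"
    \<comment> \<open>The denominator \<open>K + 1\<close> rather than \<open>K\<close> also covers
      \<open>K = 0\<close> and keeps \<open>K * d < e\<close> strict.\<close>
    define d where "d = e / (K + 1)"
    have d: "d > 0" "K * d < e" using \<open>e > 0\<close> K(1) by (auto simp: d_def field_simps)
    have "finite {js :: 'n list. length js \<le> M}"
      using finite_lists_length_le[of "UNIV :: 'n set" M] by simp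
    then have "\<forall>\<^sub>F i in sequentially. \<forall>js\<in>{js. length js \<le> M}. \<forall>x\<in>UNIV.
        dist (partial_derivs js (F i) x) (partial_derivs js f x) < d"
      by (rule eventually_ball_finite) (use uniform_limitD[OF conv d(1)] in blast)
    then show "\<forall>\<^sub>F i in sequentially. dist (u (F i)) (u f) < e"
    proof eventually_elim
      case (elim i)
      let ?g = "\<lambda>x. 1 * F i x + (- 1) * f x"
      have g: "?g \<in> smooth_torus" by (rule smooth_torus_lincomb[OF F f])
      have "cmod (partial_derivs js ?g x) \<le> d" if "length js \<le> M" for js x
        unfolding partial_derivs_lincomb[OF F f]
        using elim that by (auto simp: dist_norm intro: less_imp_le)
      then have "cmod (\<Sum>k. ?t ?g k) \<le> K * d"
        using K(2)[rule_format, OF g] by blast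
      then have "cmod (u ?g) \<le> K * d" by (simp only: u[OF g])
      moreover have "u ?g = u (F i) - u f" unfolding lin[OF F f] by simp
      ultimately show ?case using d(2) by (simp add: dist_norm)
    qed
  qed
  have "u \<in> extensional smooth_torus" by (simp add: u_def)
  then have "u \<in> distributions" using lin lim unfolding distributions_def by blast
  moreover have "fourier_coeff u = a"
  proof
    fix \<xi> :: "int ^ 'n"
    obtain k where k: "freq_enum k = \<xi>" using freq_enum_surj by blast
    have "?t (character (- \<xi>)) sums ?t (character (- \<xi>)) k"
      by (rule sums_singleI) (use k in \<open>auto simp: fint_character simp flip: k\<close>)
    then have "u (character (- \<xi>)) = a \<xi> * complex_of_real ((2 * pi) ^ CARD('n))"
      unfolding u[OF character_smooth_torus] using k by (simp add: sums_iff fint_character)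
    then show "fourier_coeff u \<xi> = a \<xi>" by (simp add: fourier_coeff_def)
  qed
  ultimately show ?thesis using u by blast
qed

text \<open>For the converse the density is the Fourier series of the coefficients: integrating it
  termwise against \<open>g\<close> gives the pairing series that represents
  \<open>u\<close>.\<close>

lemma smooth_distribution_iff:
  fixes u :: "'n::finite functional"
  assumes u: "u \<in> distributions"
  shows "u \<in> smooth_distributions \<longleftrightarrow> rapid (fourier_coeff u)"
proof
  assume "u \<in> smooth_distributions"
  then obtain f where f: "f \<in> smooth_torus" "\<And>g. g \<in> smooth_torus \<Longrightarrow> u g = integral cell (\<lambda>x. f x * g x)"
    unfolding smooth_distributions_def by blast
  have "fourier_coeff u = (\<lambda>\<xi>. fint f (- \<xi>) / complex_of_real ((2 * pi) ^ CARD('n)))"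
    by (simp add: fun_eq_iff fourier_coeff_def f(2) fint_def)
  then show "rapid (fourier_coeff u)" using smooth_torus_eq_series(1)[OF f(1)] by simp
next
  assume r: "rapid (fourier_coeff u)"
  obtain v where v: "v \<in> distributions" "fourier_coeff v = fourier_coeff u"
    "\<And>g. g \<in> smooth_torus \<Longrightarrow> v g = (\<Sum>i. fourier_coeff u (freq_enum i) * fint g (freq_enum i))"
    using tempered_distribution[OF distribution_tempered[OF u]] by blast
  have "v = u" by (rule distribution_eqI[OF v(1) u v(2)])
  have "u g = integral cell (\<lambda>x. series (fourier_coeff u) x * g x)" if "g \<in> smooth_torus" for g
    using v(3)[OF that] series_integral_sums[OF r smooth_torus_continuous_on[OF that, where js = "[]", simplified]]
    unfolding \<open>v = u\<close> by (simp add: sums_iff)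
  then show "u \<in> smooth_distributions"
    using u series_smooth_torus[OF r] unfolding smooth_distributions_def by blast
qed

section \<open>Symbols and regularity\<close>

lemma tempered_wt_powr: "tempered (\<lambda>\<xi>. complex_of_real (wt \<xi> powr s))"
proof -
  obtain N :: nat where N: "s \<le> real N" using real_arch_simple by blast
  have "wt \<xi> powr s \<le> 1 * wt \<xi> ^ N" for \<xi> :: "int ^ 'a"
    using powr_mono[OF N wt_ge_1[of \<xi>]] wt_pos[of \<xi>] by (simp add: powr_realpow)
  then show ?thesis unfolding tempered_def by (intro exI[of _ N] exI[of _ 1]) auto
qed

lemma wt_powr_half_square: "(wt \<xi> powr (s / 2))\<^sup>2 = wt \<xi> powr s"
  by (simp add: power2_eq_square flip: powr_add)

lemma tempered_bounded:
  assumes "tempered b" "\<And>\<xi>. cmod (a \<xi>) \<le> C * cmod (b \<xi>)" "0 \<le> C"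
  shows "tempered a"
proof -
  obtain N B where B: "\<And>\<xi>. cmod (b \<xi>) \<le> B * wt \<xi> ^ N" using assms(1) temperedD by blast
  have "cmod (a \<xi>) \<le> (C * B) * wt \<xi> ^ N" for \<xi>
    using assms(2)[of \<xi>] mult_left_mono[OF B[of \<xi>] assms(3)] by (simp add: mult.assoc)
  then show ?thesis unfolding tempered_def by blast
qed

lemma symbol_of_order_tempered:
  assumes "symbol_of_order m p"
  shows "tempered p"
proof -
  obtain C where "C > 0" "\<And>\<xi>. cmod (p \<xi>) \<le> C * wt \<xi> powr (m / 2)"
    using assms unfolding symbol_of_order_def wt_def by blast
  then show ?thesis
    by (intro tempered_bounded[OF tempered_wt_powr[of "m / 2"], of p C]) auto
qed

text \<open>Discharges the definite description: existence because the product of tempered families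
  is tempered, uniqueness because coefficients determine a distribution.\<close>

lemma fourier_multiplier:
  assumes "tempered p" "u \<in> distributions"
  shows "fourier_multiplier p u \<in> distributions"
    and "fourier_coeff (fourier_multiplier p u) = (\<lambda>\<xi>. p \<xi> * fourier_coeff u \<xi>)"
proof -
  let ?P = "\<lambda>v. v \<in> distributions \<and> (\<forall>\<xi>. fourier_coeff v \<xi> = p \<xi> * fourier_coeff u \<xi>)"
  obtain v where v: "v \<in> distributions" "fourier_coeff v = (\<lambda>\<xi>. p \<xi> * fourier_coeff u \<xi>)"
    using tempered_distribution[OF tempered_mult[OF assms(1) distribution_tempered[OF assms(2)]]] by blast
  have "?P (THE v. ?P v)"
  proof (rule theI[of ?P v])
    show "?P v" using v by simp
    show "w = v" if "?P w" for w
      by (rule distribution_eqI) (use that v in auto)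
  qed
  then show "fourier_multiplier p u \<in> distributions"
    "fourier_coeff (fourier_multiplier p u) = (\<lambda>\<xi>. p \<xi> * fourier_coeff u \<xi>)"
    unfolding fourier_multiplier_def by auto
qed

lemma sobolev_iff:
  assumes "u \<in> distributions"
  shows "u \<in> sobolev k \<longleftrightarrow> (\<lambda>\<xi>. wt \<xi> powr k * (cmod (fourier_coeff u \<xi>))\<^sup>2) summable_on UNIV"
  using assms by (simp add: sobolev_def wt_def)

lemma sobolev_regularity_iff:
  fixes p :: "int ^ 'n::finite \<Rightarrow> complex"
  assumes "tempered p"
  shows "sobolev_regularity m p r \<longleftrightarrow>
    (\<forall>k a. tempered a \<longrightarrow> (\<lambda>\<xi>. wt \<xi> powr k * (cmod (p \<xi> * a \<xi>))\<^sup>2) summable_on UNIV \<longrightarrow>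
       (\<lambda>\<xi>. wt \<xi> powr (k + m - r) * (cmod (a \<xi>))\<^sup>2) summable_on UNIV)" (is "_ \<longleftrightarrow> ?R")
proof
  assume L: "sobolev_regularity m p r"
  show ?R
  proof (intro allI impI)
    fix k and a :: "int ^ 'n \<Rightarrow> complex"
    assume "tempered a" and s: "(\<lambda>\<xi>. wt \<xi> powr k * (cmod (p \<xi> * a \<xi>))\<^sup>2) summable_on UNIV"
    then obtain u where u: "u \<in> distributions" "fourier_coeff u = a"
      using tempered_distribution by blast
    then have "fourier_multiplier p u \<in> sobolev k"
      using s fourier_multiplier[OF assms u(1)] by (simp add: sobolev_iff)
    then have "u \<in> sobolev (k + m - r)" using L u(1) unfolding sobolev_regularity_def by blast
    then show "(\<lambda>\<xi>. wt \<xi> powr (k + m - r) * (cmod (a \<xi>))\<^sup>2) summable_on UNIV"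
      using u by (simp add: sobolev_iff)
  qed
next
  assume R: ?R
  show "sobolev_regularity m p r"
    unfolding sobolev_regularity_def
  proof (intro allI ballI impI)
    fix k u assume u: "u \<in> distributions" "fourier_multiplier p u \<in> sobolev k"
    then show "u \<in> sobolev (k + m - r)"
      using R distribution_tempered[OF u(1)] fourier_multiplier[OF assms u(1)]
      by (simp add: sobolev_iff)
  qed
qed

lemma globally_hypoelliptic_iff:
  fixes p :: "int ^ 'n::finite \<Rightarrow> complex"
  assumes "tempered p"
  shows "globally_hypoelliptic p \<longleftrightarrow>
    (\<forall>a. tempered a \<longrightarrow> rapid (\<lambda>\<xi>. p \<xi> * a \<xi>) \<longrightarrow> rapid a)" (is "_ \<longleftrightarrow> ?R")
proof
  assume L: "globally_hypoelliptic p"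
  show ?R
  proof (intro allI impI)
    fix a :: "int ^ 'n \<Rightarrow> complex"
    assume "tempered a" and s: "rapid (\<lambda>\<xi>. p \<xi> * a \<xi>)"
    then obtain u where u: "u \<in> distributions" "fourier_coeff u = a"
      using tempered_distribution by blast
    then have "fourier_multiplier p u \<in> smooth_distributions"
      using s fourier_multiplier[OF assms u(1)] by (simp add: smooth_distribution_iff)
    then show "rapid a"
      using L u smooth_distribution_iff unfolding globally_hypoelliptic_def by blast
  qed
next
  assume R: ?R
  show "globally_hypoelliptic p"
    unfolding globally_hypoelliptic_def
  proof (intro ballI impI)
    fix u assume u: "u \<in> distributions" "fourier_multiplier p u \<in> smooth_distributions"
    then show "u \<in> smooth_distributions"
      using R distribution_tempered[OF u(1)] fourier_multiplier[OF assms u(1)]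
      by (simp add: smooth_distribution_iff)
  qed
qed

section \<open>Comparison of the norms in the lower bound\<close>

lemma powr_le_comparable:
  fixes x y c s :: real
  assumes "0 < x" "0 < y" "x \<le> c * y" "y \<le> c * x" "1 \<le> c"
  shows "x powr s \<le> c powr \<bar>s\<bar> * y powr s"
proof (cases "s \<ge> 0")
  case True
  have "x powr s \<le> (c * y) powr s" using assms True by (intro powr_mono2) auto
  then show ?thesis using assms True by (simp add: powr_mult)
next
  case False
  have "(c * x) powr s \<le> y powr s" using assms False by (intro powr_mono2') auto
  then have "c powr s * x powr s \<le> y powr s" using assms by (simp add: powr_mult)
  then have "c powr (- s) * (c powr s * x powr s) \<le> c powr (- s) * y powr s"
    by (intro mult_left_mono) auto
  moreover have "c powr (- s) * (c powr s * x powr s) = x powr s"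
    using assms by (simp add: powr_add[symmetric] mult.assoc[symmetric])
  ultimately show ?thesis using False by simp
qed

lemma l1_norm_ge_1:
  assumes "\<xi> \<noteq> 0"
  shows "1 \<le> l1_norm \<xi>"
proof -
  obtain j where j: "\<xi> $ j \<noteq> 0" using assms by (auto simp: vec_eq_iff)
  then have "1 \<le> \<bar>real_of_int (\<xi> $ j)\<bar>" by linarith
  also have "\<dots> \<le> l1_norm \<xi>"
    unfolding l1_norm_def by (intro member_le_sum) auto
  finally show ?thesis .
qed

text \<open>The factor 2 absorbs the summand 1 of the weight, as the squared norm is at least 1 off
  the origin; the square of the dimension comes from bounding each coordinate by the Euclidean norm.
  One constant serves both directions.\<close>

lemma l1_norm_wt_comparable:
  fixes \<xi> :: "int ^ 'n::finite"
  assumes "\<xi> \<noteq> 0"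
  defines "c \<equiv> 2 * (real CARD('n))\<^sup>2"
  shows "1 \<le> c" "wt \<xi> \<le> c * (l1_norm \<xi>)\<^sup>2" "(l1_norm \<xi>)\<^sup>2 \<le> c * wt \<xi>"
proof -
  have n1: "1 \<le> (real CARD('n))\<^sup>2" by (simp add: Suc_leI)
  then show "1 \<le> c" unfolding c_def by linarith
  have l1: "1 \<le> l1_norm \<xi>" by (rule l1_norm_ge_1[OF assms(1)])
  have "norm (freq \<xi>) \<le> l1_norm \<xi>"
    using norm_le_l1_cart[of "freq \<xi>"] by (simp add: l1_norm_def freq_def)
  then have "(norm (freq \<xi>))\<^sup>2 \<le> (l1_norm \<xi>)\<^sup>2" by (intro power_mono) auto
  moreover have "1 \<le> (l1_norm \<xi>)\<^sup>2" using l1 by simp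
  ultimately have "wt \<xi> \<le> 2 * (l1_norm \<xi>)\<^sup>2" by (simp add: wt_def)
  also have "\<dots> \<le> c * (l1_norm \<xi>)\<^sup>2" unfolding c_def using n1 by (intro mult_right_mono) auto
  finally show "wt \<xi> \<le> c * (l1_norm \<xi>)\<^sup>2" .
  have "l1_norm \<xi> \<le> (\<Sum>j\<in>(UNIV::'n set). norm (freq \<xi>))"
    unfolding l1_norm_def
  proof (rule sum_mono)
    fix j show "\<bar>real_of_int (\<xi> $ j)\<bar> \<le> norm (freq \<xi>)"
      using component_le_norm_cart[of "freq \<xi>" j] by (simp add: freq_def)
  qed
  then have "l1_norm \<xi> \<le> real CARD('n) * norm (freq \<xi>)" by simp
  then have "(l1_norm \<xi>)\<^sup>2 \<le> (real CARD('n) * norm (freq \<xi>))\<^sup>2"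
    using l1 by (intro power_mono) auto
  also have "\<dots> = (real CARD('n))\<^sup>2 * (norm (freq \<xi>))\<^sup>2" by (simp add: power_mult_distrib)
  also have "\<dots> \<le> c * wt \<xi>" unfolding c_def wt_def by (intro mult_mono) auto
  finally show "(l1_norm \<xi>)\<^sup>2 \<le> c * wt \<xi>" .
qed

lemma l1_norm_wt_powr:
  fixes \<xi> :: "int ^ 'n::finite"
  assumes "\<xi> \<noteq> 0"
  defines "c \<equiv> 2 * (real CARD('n))\<^sup>2"
  shows "wt \<xi> powr (s / 2) \<le> c powr \<bar>s / 2\<bar> * l1_norm \<xi> powr s"
    and "l1_norm \<xi> powr s \<le> c powr \<bar>s / 2\<bar> * wt \<xi> powr (s / 2)"
proof -
  have l1: "1 \<le> l1_norm \<xi>" by (rule l1_norm_ge_1[OF assms(1)])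
  have eq: "((l1_norm \<xi>)\<^sup>2) powr (s / 2) = l1_norm \<xi> powr s"
    using l1 by (simp add: powr_powr flip: powr_numeral)
  have pos: "0 < (l1_norm \<xi>)\<^sup>2" using l1 by simp
  note c = l1_norm_wt_comparable[OF assms(1), folded c_def]
  show "wt \<xi> powr (s / 2) \<le> c powr \<bar>s / 2\<bar> * l1_norm \<xi> powr s"
    using powr_le_comparable[OF wt_pos pos c(2,3,1), of "s / 2"] eq by simp
  show "l1_norm \<xi> powr s \<le> c powr \<bar>s / 2\<bar> * wt \<xi> powr (s / 2)"
    using powr_le_comparable[OF pos wt_pos c(3,2,1), of "s / 2"] eq by simp
qed

lemma symbol_lower_bound_iff:
  fixes p :: "int ^ 'n::finite \<Rightarrow> complex"
  shows "symbol_lower_bound m p s \<longleftrightarrow> finite {\<xi>. p \<xi> = 0} \<and>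
    (\<exists>C>0. \<forall>\<xi>. p \<xi> \<noteq> 0 \<longrightarrow> C * wt \<xi> powr ((m - s) / 2) \<le> cmod (p \<xi>))"
    (is "_ \<longleftrightarrow> ?F \<and> (\<exists>C>0. ?R C)")
proof -
  define K where "K = (2 * (real CARD('n))\<^sup>2) powr \<bar>(m - s) / 2\<bar>"
  have K: "K > 0" by (simp add: K_def)
  have 1: "\<exists>C'>0. ?R C'"
    if C: "C > 0" "\<forall>\<xi>. \<xi> \<noteq> 0 \<longrightarrow> p \<xi> \<noteq> 0 \<longrightarrow> cmod (p \<xi>) \<ge> C * l1_norm \<xi> powr (m - s)" for C
  proof -
    \<comment> \<open>The weighted form includes the frequency 0, about which the original bound
      says nothing. There the weight is 1, so it suffices to keep the constant below
      \<open>cmod (p 0)\<close> when that is nonzero.\<close>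
    define C' where "C' = (if p 0 = 0 then C / K else min (C / K) (cmod (p 0)))"
    have C': "C' > 0" "C' \<le> C / K" using C K by (auto simp: C'_def)
    have "C' * wt \<xi> powr ((m - s) / 2) \<le> cmod (p \<xi>)" if p: "p \<xi> \<noteq> 0" for \<xi>
    proof (cases "\<xi> = 0")
      case True
      have "wt (0 :: int ^ 'n) = 1" by (simp add: wt_eq_sum)
      then show ?thesis using True p by (simp add: C'_def)
    next
      case False
      have "C' * wt \<xi> powr ((m - s) / 2) \<le> C / K * (K * l1_norm \<xi> powr (m - s))"
        using l1_norm_wt_powr(1)[OF False, of "m - s"] C' C K
        by (intro mult_mono) (auto simp: K_def)
      also have "\<dots> = C * l1_norm \<xi> powr (m - s)" using K by simp
      also have "\<dots> \<le> cmod (p \<xi>)" using C(2) False p by blast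
      finally show ?thesis .
    qed
    then show ?thesis using C'(1) by blast
  qed
  have 2: "\<exists>C'>0. \<forall>\<xi>. \<xi> \<noteq> 0 \<longrightarrow> p \<xi> \<noteq> 0 \<longrightarrow> cmod (p \<xi>) \<ge> C' * l1_norm \<xi> powr (m - s)"
    if C: "C > 0" "?R C" for C
  proof -
    have "C / K * l1_norm \<xi> powr (m - s) \<le> cmod (p \<xi>)" if "\<xi> \<noteq> 0" "p \<xi> \<noteq> 0" for \<xi>
    proof -
      have "C / K * l1_norm \<xi> powr (m - s) \<le> C / K * (K * wt \<xi> powr ((m - s) / 2))"
        using l1_norm_wt_powr(2)[OF that(1), of "m - s"] C K
        by (intro mult_left_mono) (auto simp: K_def)
      also have "\<dots> = C * wt \<xi> powr ((m - s) / 2)" using K by simp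
      also have "\<dots> \<le> cmod (p \<xi>)" using C(2) that by blast
      finally show ?thesis .
    qed
    then show ?thesis using C K by (intro exI[of _ "C / K"]) auto
  qed
  show ?thesis
    unfolding symbol_lower_bound_def
    by (rule conj_cong[OF refl], rule iffI; elim exE conjE) (erule (1) 1, erule (1) 2)
qed

section \<open>Lower bounds and the two kinds of regularity\<close>

lemma rapid_indicator_imp_finite:
  assumes "rapid (\<lambda>\<xi>. if \<xi> \<in> S then 1 else 0)"
  shows "finite S"
proof (rule summable_on_indicator_imp_finite)
  show "(\<lambda>\<xi>. if \<xi> \<in> S then 1 else 0 :: real) summable_on UNIV"
    using rapid_abs_summable[OF assms] by (simp add: if_distrib cong: if_cong)
qed

lemma summable_on_finite_change:
  fixes f g :: "'a \<Rightarrow> real"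
  assumes "f summable_on UNIV" "finite Z" "\<And>x. x \<notin> Z \<Longrightarrow> 0 \<le> g x \<and> g x \<le> f x"
  shows "g summable_on UNIV"
proof -
  have "g summable_on (- Z)"
    by (rule summable_on_comparison_test[OF summable_on_subset[OF assms(1)]]) (use assms(3) in auto)
  then have "g summable_on (- Z \<union> Z)" using assms(2) by (intro summable_on_union) auto
  then show ?thesis by simp
qed

text \<open>Squaring the lower bound gives \<open>wt \<xi> powr (m - r) \<le> (cmod (p
  \<xi>))\<^sup>2 / C\<^sup>2\<close> off the zeros of \<open>p\<close>. The finitely many remaining
  frequencies do not affect summability.\<close>

lemma symbol_lower_bound_imp_sobolev_regularity:
  fixes p :: "int ^ 'n::finite \<Rightarrow> complex"
  assumes "tempered p" "symbol_lower_bound m p r"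
  shows "sobolev_regularity m p r"
  unfolding sobolev_regularity_iff[OF assms(1)]
proof (intro allI impI)
  fix k and a :: "int ^ 'n \<Rightarrow> complex"
  assume s: "(\<lambda>\<xi>. wt \<xi> powr k * (cmod (p \<xi> * a \<xi>))\<^sup>2) summable_on UNIV"
  obtain C where C: "C > 0" "\<And>\<xi>. p \<xi> \<noteq> 0 \<Longrightarrow> C * wt \<xi> powr ((m - r) / 2) \<le> cmod (p \<xi>)"
    and Z: "finite {\<xi>. p \<xi> = 0}"
    using assms(2) unfolding symbol_lower_bound_iff by blast
  show "(\<lambda>\<xi>. wt \<xi> powr (k + m - r) * (cmod (a \<xi>))\<^sup>2) summable_on UNIV"
  proof (rule summable_on_finite_change[OF _ Z])
    show "(\<lambda>\<xi>. 1 / C\<^sup>2 * (wt \<xi> powr k * (cmod (p \<xi> * a \<xi>))\<^sup>2)) summable_on UNIV"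
      by (rule summable_on_cmult_right[OF s])
    fix \<xi> assume "\<xi> \<notin> {\<xi>. p \<xi> = 0}"
    then have "(C * wt \<xi> powr ((m - r) / 2))\<^sup>2 \<le> (cmod (p \<xi>))\<^sup>2"
      using C by (intro power_mono) auto
    then have "wt \<xi> powr (m - r) \<le> (cmod (p \<xi>))\<^sup>2 / C\<^sup>2"
      using C(1) by (simp add: power_mult_distrib wt_powr_half_square field_simps)
    then have "wt \<xi> powr k * wt \<xi> powr (m - r) * (cmod (a \<xi>))\<^sup>2
        \<le> wt \<xi> powr k * ((cmod (p \<xi>))\<^sup>2 / C\<^sup>2) * (cmod (a \<xi>))\<^sup>2"
      by (intro mult_right_mono mult_left_mono) auto
    moreover have "wt \<xi> powr (k + m - r) = wt \<xi> powr k * wt \<xi> powr (m - r)"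
      by (simp add: powr_add[symmetric] add_diff_eq)
    ultimately show "0 \<le> wt \<xi> powr (k + m - r) * (cmod (a \<xi>))\<^sup>2 \<and>
        wt \<xi> powr (k + m - r) * (cmod (a \<xi>))\<^sup>2 \<le> 1 / C\<^sup>2 * (wt \<xi> powr k * (cmod (p \<xi> * a \<xi>))\<^sup>2)"
      by (simp add: norm_mult power_mult_distrib mult_ac)
  qed
qed

lemma not_lower_boundE:
  fixes p :: "int ^ 'n::finite \<Rightarrow> complex"
  assumes "\<not> (\<exists>C>0. \<forall>\<xi>. p \<xi> \<noteq> 0 \<longrightarrow> C * wt \<xi> powr t \<le> cmod (p \<xi>))" "0 < C"
  obtains \<xi> where "p \<xi> \<noteq> 0" "cmod (p \<xi>) < C * wt \<xi> powr t"
  using assms by (meson not_le)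

lemma sobolev_regularity_imp_symbol_lower_bound:
  fixes p :: "int ^ 'n::finite \<Rightarrow> complex"
  assumes "tempered p" "sobolev_regularity m p r"
  shows "symbol_lower_bound m p r"
  unfolding symbol_lower_bound_iff
proof
  note reg = assms(2)[unfolded sobolev_regularity_iff[OF assms(1)], rule_format]
  show "finite {\<xi>. p \<xi> = 0}"
  proof (rule summable_on_indicator_imp_finite)
    \<comment> \<open>The indicator of the zero set is annihilated by \<open>p\<close>, so it passes
      the hypothesis for every \<open>k\<close>. With \<open>k = r - m\<close> the weight in the
      conclusion is 1, and summability counts the zeros.\<close>
    let ?a = "\<lambda>\<xi>. if \<xi> \<in> {\<xi>. p \<xi> = 0} then 1 else 0 :: complex"
    have "(\<lambda>\<xi>. wt \<xi> powr (r - m) * (cmod (p \<xi> * ?a \<xi>))\<^sup>2) = (\<lambda>\<xi>. 0)" by auto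
    then have "(\<lambda>\<xi>. wt \<xi> powr (r - m + m - r) * (cmod (?a \<xi>))\<^sup>2) summable_on UNIV"
      by (intro reg tempered_indicator) simp
    moreover have "(\<lambda>\<xi>. wt \<xi> powr (r - m + m - r) * (cmod (?a \<xi>))\<^sup>2)
        = (\<lambda>\<xi>. if \<xi> \<in> {\<xi>. p \<xi> = 0} then 1 else 0 :: real)"
      by (auto simp: fun_eq_iff)
    ultimately show "(\<lambda>\<xi>. if \<xi> \<in> {\<xi>. p \<xi> = 0} then 1 else 0 :: real) summable_on UNIV" by simp
  qed
  show "\<exists>C>0. \<forall>\<xi>. p \<xi> \<noteq> 0 \<longrightarrow> C * wt \<xi> powr ((m - r) / 2) \<le> cmod (p \<xi>)"
  proof (rule ccontr)
    assume neg: "\<not> ?thesis"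
    \<comment> \<open>The quotient that would be bounded below. Choosing frequencies where it is
      under \<open>(1 / 2) ^ i\<close> makes its squares summable along the sequence.\<close>
    define q where "q = (\<lambda>\<xi>. cmod (p \<xi>) / wt \<xi> powr ((m - r) / 2))"
    have "\<exists>\<xi>. p \<xi> \<noteq> 0 \<and> q \<xi> < (1 / 2) ^ i" for i :: nat
    proof -
      obtain \<xi> where "p \<xi> \<noteq> 0" "cmod (p \<xi>) < (1 / 2) ^ i * wt \<xi> powr ((m - r) / 2)"
        using not_lower_boundE[OF neg, of "(1 / 2) ^ i"] by auto
      then show ?thesis using wt_pos[of \<xi>]
        by (intro exI[of _ \<xi>]) (auto simp: q_def divide_less_eq)
    qed
    then obtain g where g: "\<And>i. p (g i) \<noteq> 0" "\<And>i. q (g i) < (1 / 2) ^ i" by metis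
    have q0: "0 < q (g i)" for i using g(1)[of i] wt_pos[of "g i"] by (simp add: q_def)
    have "infinite (range g)"
    proof (rule infinite_range_if_tendsto_0[of q])
      show "(\<lambda>i. q (g i)) \<longlonglongrightarrow> 0"
        by (rule tendsto_sandwich[of "\<lambda>_. 0" _ _ "\<lambda>i. (1 / 2) ^ i"])
          (use q0 g(2) in \<open>auto intro!: always_eventually less_imp_le LIMSEQ_power_zero\<close>)
    qed (rule q0)
    \<comment> \<open>Normalised so that on \<open>range g\<close> the modulus of
      \<open>p * a\<close> is \<open>q\<close>, hence square summable (\<open>k = 0\<close>), while
      the weighted square of \<open>a\<close> in the conclusion is exactly 1 on this infinite
      set.\<close>
    define a where "a = (\<lambda>\<xi>. (if \<xi> \<in> range g then 1 else 0) * complex_of_real (wt \<xi> powr (- ((m - r) / 2))))"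
    have "tempered a" unfolding a_def by (rule tempered_mult[OF tempered_indicator tempered_wt_powr])
    moreover have "(\<lambda>\<xi>. wt \<xi> powr 0 * (cmod (p \<xi> * a \<xi>))\<^sup>2) summable_on UNIV"
    proof -
      have "(\<lambda>i. (q (g i))\<^sup>2) summable_on UNIV"
      proof (rule summable_on_comparison_test)
        have "summable (\<lambda>i::nat. (1 / 4 :: real) ^ i)" by (rule summable_geometric) simp
        then show "(\<lambda>i::nat. (1 / 4 :: real) ^ i) summable_on UNIV"
          by (subst summable_on_UNIV_nonneg_real_iff) auto
        show "(q (g i))\<^sup>2 \<le> (1 / 4) ^ i" for i
        proof -
          have "(q (g i))\<^sup>2 \<le> ((1 / 2) ^ i)\<^sup>2"
            using g(2)[of i] q0[of i] by (intro power_mono) auto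
          also have "\<dots> = (1 / 4) ^ i" by (simp add: power2_eq_square flip: power_mult_distrib)
          finally show ?thesis .
        qed
      qed auto
      then have "(\<lambda>\<xi>. (q \<xi>)\<^sup>2) summable_on range g" by (rule summable_on_range)
      then have "(\<lambda>\<xi>. wt \<xi> powr 0 * (cmod (p \<xi> * a \<xi>))\<^sup>2) summable_on range g"
        by (rule summable_on_cong[THEN iffD1, rotated])
          (auto simp: a_def q_def norm_mult norm_divide powr_minus_divide)
      then show ?thesis
        by (rule summable_on_cong_neutral[THEN iffD1, rotated -1]) (auto simp: a_def)
    qed
    ultimately have "(\<lambda>\<xi>. wt \<xi> powr (0 + m - r) * (cmod (a \<xi>))\<^sup>2) summable_on UNIV" by (rule reg)
    moreover have "wt \<xi> powr (0 + m - r) * (cmod (a \<xi>))\<^sup>2 = (if \<xi> \<in> range g then 1 else 0)" for \<xi>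
    proof -
      have "(cmod (a \<xi>))\<^sup>2 = (if \<xi> \<in> range g then (wt \<xi> powr (- (m - r) / 2))\<^sup>2 else 0)"
        by (simp add: a_def norm_mult minus_divide_left)
      also have "\<dots> = (if \<xi> \<in> range g then wt \<xi> powr (- (m - r)) else 0)"
        by (simp only: wt_powr_half_square)
      finally show ?thesis by (simp add: powr_add[symmetric])
    qed
    ultimately have "finite (range g)" using summable_on_indicator_imp_finite[of "range g"] by simp
    then show False using \<open>infinite (range g)\<close> by contradiction
  qed
qed

text \<open>Off the zeros of \<open>p\<close>, dividing by \<open>p\<close> costs at most a power of
  the weight, and rapid decay survives multiplication by any such power.\<close>

lemma symbol_lower_bound_imp_globally_hypoelliptic:
  fixes p :: "int ^ 'n::finite \<Rightarrow> complex"
  assumes "tempered p" "symbol_lower_bound m p s"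
  shows "globally_hypoelliptic p"
  unfolding globally_hypoelliptic_iff[OF assms(1)]
proof (intro allI impI)
  fix a :: "int ^ 'n \<Rightarrow> complex"
  assume pa: "rapid (\<lambda>\<xi>. p \<xi> * a \<xi>)"
  obtain C where C: "C > 0" "\<And>\<xi>. p \<xi> \<noteq> 0 \<Longrightarrow> C * wt \<xi> powr ((m - s) / 2) \<le> cmod (p \<xi>)"
    and Z: "finite {\<xi>. p \<xi> = 0}"
    using assms(2) unfolding symbol_lower_bound_iff by blast
  define b where "b = (\<lambda>\<xi>. complex_of_real (wt \<xi> powr (- ((m - s) / 2))) * (p \<xi> * a \<xi>))"
  have b: "rapid b" unfolding b_def by (rule rapid_mult_tempered[OF pa tempered_wt_powr])
  have ab: "cmod (a \<xi>) \<le> 1 / C * cmod (b \<xi>)" if "p \<xi> \<noteq> 0" for \<xi>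
  proof -
    have "C * wt \<xi> powr ((m - s) / 2) * cmod (a \<xi>) \<le> cmod (p \<xi>) * cmod (a \<xi>)"
      using C(2)[OF that] by (intro mult_right_mono) auto
    moreover have "cmod (b \<xi>) = cmod (p \<xi>) * cmod (a \<xi>) / wt \<xi> powr ((m - s) / 2)"
      unfolding b_def by (simp add: norm_mult norm_divide powr_minus_divide)
    ultimately have "C * cmod (a \<xi>) \<le> cmod (b \<xi>)"
      using wt_pos[of \<xi>] by (simp add: le_divide_eq mult_ac)
    then show ?thesis using C(1) by (simp add: le_divide_eq mult_ac)
  qed
  show "rapid a"
    unfolding rapid_def
  proof
    fix N
    obtain B where B: "B > 0" "\<And>\<xi>. cmod (b \<xi>) * wt \<xi> ^ N \<le> B" using b rapidD by blast
    \<comment> \<open>Total contribution of the finitely many zeros of \<open>p\<close>, where the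
      product \<open>p * a\<close> gives no information about \<open>a\<close>.\<close>
    let ?E = "\<Sum>\<xi> | p \<xi> = 0. cmod (a \<xi>) * wt \<xi> ^ N"
    have nn: "0 \<le> cmod (a \<xi>) * wt \<xi> ^ N" for \<xi> using wt_pos[of \<xi>] by simp
    have "cmod (a \<xi>) * wt \<xi> ^ N \<le> B / C + ?E" for \<xi>
    proof (cases "p \<xi> = 0")
      case True
      then have "cmod (a \<xi>) * wt \<xi> ^ N \<le> ?E" using Z nn by (intro member_le_sum) auto
      then show ?thesis using B(1) C(1) by (simp add: add_increasing)
    next
      case False
      have "cmod (a \<xi>) * wt \<xi> ^ N \<le> 1 / C * cmod (b \<xi>) * wt \<xi> ^ N"
        using ab[OF False] wt_pos[of \<xi>] by (intro mult_right_mono) auto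
      also have "\<dots> \<le> B / C" using B(2)[of \<xi>] C(1) by (simp add: divide_right_mono)
      also have "\<dots> \<le> B / C + ?E" using nn by (simp add: sum_nonneg)
      finally show ?thesis .
    qed
    then show "\<exists>C. \<forall>\<xi>. cmod (a \<xi>) * wt \<xi> ^ N \<le> C" by blast
  qed
qed

text \<open>If the bound fails for every natural exponent, a frequency \<open>g i\<close> violating
  the one with exponent \<open>i\<close> can be chosen for each \<open>i\<close>. The indicator of
  \<open>range g\<close> is then made rapid by \<open>p\<close> without being rapid itself.\<close>

lemma globally_hypoelliptic_imp_symbol_lower_bound:
  fixes p :: "int ^ 'n::finite \<Rightarrow> complex"
  assumes "tempered p" "globally_hypoelliptic p"
  shows "\<exists>s\<ge>0. symbol_lower_bound m p s"
proof (rule ccontr)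
  assume neg: "\<not> ?thesis"
  note hyp = assms(2)[unfolded globally_hypoelliptic_iff[OF assms(1)], rule_format]
  have Z: "finite {\<xi>. p \<xi> = 0}"
  proof (rule rapid_indicator_imp_finite, rule hyp[OF tempered_indicator])
    have "(\<lambda>\<xi>. p \<xi> * (if \<xi> \<in> {\<xi>. p \<xi> = 0} then 1 else 0)) = (\<lambda>_. 0)" by auto
    then show "rapid (\<lambda>\<xi>. p \<xi> * (if \<xi> \<in> {\<xi>. p \<xi> = 0} then 1 else 0))" by (simp add: rapid_def) blast
  qed
  \<comment> \<open>The vanishing factor \<open>1 / real (Suc i)\<close> guarantees that infinitely
    many different frequencies occur; powers of the weight alone would not exclude the frequency 0,
    where the weight is 1.\<close>
  have "\<exists>\<xi>. p \<xi> \<noteq> 0 \<and> cmod (p \<xi>) < 1 / real (Suc i) * wt \<xi> powr ((m - real i) / 2)" for i :: nat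
  proof -
    have "\<not> symbol_lower_bound m p (real i)" using neg by simp
    then have "\<not> (\<exists>C>0. \<forall>\<xi>. p \<xi> \<noteq> 0 \<longrightarrow> C * wt \<xi> powr ((m - real i) / 2) \<le> cmod (p \<xi>))"
      using Z unfolding symbol_lower_bound_iff by blast
    from not_lower_boundE[OF this, of "1 / real (Suc i)"] show ?thesis by auto
  qed
  then obtain g where g: "\<And>i. p (g i) \<noteq> 0"
      "\<And>i. cmod (p (g i)) < 1 / real (Suc i) * wt (g i) powr ((m - real i) / 2)" by metis
  \<comment> \<open>Here the exponent is fixed, independent of \<open>i\<close>, so that
    \<open>q\<close> is a single function tending to 0 along \<open>g\<close>.\<close>
  define q where "q = (\<lambda>\<xi>. cmod (p \<xi>) / wt \<xi> powr (m / 2))"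
  have q0: "0 < q (g i)" for i using g(1)[of i] wt_pos[of "g i"] by (simp add: q_def)
  have ql: "q (g i) \<le> 1 / real (Suc i)" for i
  proof -
    have "wt (g i) powr ((m - real i) / 2) \<le> wt (g i) powr (m / 2)"
      using wt_ge_1[of "g i"] by (intro powr_mono) auto
    then have "1 / real (Suc i) * wt (g i) powr ((m - real i) / 2) \<le> 1 / real (Suc i) * wt (g i) powr (m / 2)"
      by (intro mult_left_mono) auto
    then have "cmod (p (g i)) \<le> 1 / real (Suc i) * wt (g i) powr (m / 2)" using g(2)[of i] by linarith
    then show ?thesis using wt_pos[of "g i"] by (simp add: q_def divide_le_eq del: of_nat_Suc)
  qed
  have "infinite (range g)"
  proof (rule infinite_range_if_tendsto_0[of q])
    show "(\<lambda>i. q (g i)) \<longlonglongrightarrow> 0"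
      by (rule tendsto_sandwich[of "\<lambda>_. 0" _ _ "\<lambda>i. 1 / real (Suc i)"])
        (use q0 ql LIMSEQ_inverse_real_of_nat in \<open>auto intro!: always_eventually less_imp_le simp: inverse_eq_divide\<close>)
  qed (rule q0)
  moreover have "rapid (\<lambda>\<xi>. p \<xi> * (if \<xi> \<in> range g then 1 else 0))"
    unfolding rapid_def
  proof
    fix N
    \<comment> \<open>From \<open>J\<close> on the exponent \<open>(m - i) / 2\<close> is at most
      \<open>- N\<close>, which cancels \<open>wt \<xi> ^ N\<close>. The earlier indices are
      finitely many, and their contribution is collected in \<open>E\<close>.\<close>
    obtain J :: nat where J: "m + 2 * real N \<le> real J" using real_arch_simple by blast
    have nn: "0 \<le> cmod (p \<xi>) * wt \<xi> ^ N" for \<xi> using wt_pos[of \<xi>] by simp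
    define E where "E = (\<Sum>i<J. cmod (p (g i)) * wt (g i) ^ N)"
    have E0: "E \<ge> 0" unfolding E_def using nn by (intro sum_nonneg)
    have "cmod (p (g i)) * wt (g i) ^ N \<le> 1 + E" for i
    proof (cases "i < J")
      case True
      have "cmod (p (g i)) * wt (g i) ^ N \<le> E"
        unfolding E_def using True nn by (intro member_le_sum) auto
      then show ?thesis by simp
    next
      case False
      have "wt (g i) powr ((m - real i) / 2) \<le> wt (g i) powr (- real N)"
        using J False wt_ge_1[of "g i"] by (intro powr_mono) auto
      moreover have "1 / real (Suc i) * wt (g i) powr ((m - real i) / 2) \<le> wt (g i) powr ((m - real i) / 2)"
        by (intro mult_left_le_one_le) auto
      ultimately have "cmod (p (g i)) \<le> wt (g i) powr (- real N)" using g(2)[of i] by linarith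
      then have "cmod (p (g i)) * wt (g i) ^ N \<le> wt (g i) powr (- real N) * wt (g i) ^ N"
        using wt_pos[of "g i"] by (intro mult_right_mono) auto
      also have "\<dots> = 1" using wt_pos[of "g i"] by (simp add: powr_minus powr_realpow)
      finally show ?thesis using E0 by simp
    qed
    then have "cmod (p \<xi> * (if \<xi> \<in> range g then 1 else 0)) * wt \<xi> ^ N \<le> 1 + E" for \<xi>
      using E0 by auto
    then show "\<exists>C. \<forall>\<xi>. cmod (p \<xi> * (if \<xi> \<in> range g then 1 else 0)) * wt \<xi> ^ N \<le> C" by blast
  qed
  from hyp[OF tempered_indicator this] have "finite (range g)" by (rule rapid_indicator_imp_finite)
  ultimately show False by contradiction
qed

theorem theorem1p1:
  fixes p :: "int ^ 'n::finite \<Rightarrow> complex" and m r :: real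
  assumes "symbol_of_order m p" and "r \<ge> 0"
  shows "(symbol_lower_bound m p r \<longleftrightarrow> sobolev_regularity m p r) \<and>
         (globally_hypoelliptic p \<longleftrightarrow> (\<exists>s\<ge>0. symbol_lower_bound m p s)) \<and>
         (globally_hypoelliptic p \<longleftrightarrow> (\<exists>s\<ge>0. sobolev_regularity m p s))"
proof -
  note p = symbol_of_order_tempered[OF assms(1)]
  have "symbol_lower_bound m p s \<longleftrightarrow> sobolev_regularity m p s" for s
    using p symbol_lower_bound_imp_sobolev_regularity sobolev_regularity_imp_symbol_lower_bound by blast
  moreover have "globally_hypoelliptic p \<longleftrightarrow> (\<exists>s\<ge>0. symbol_lower_bound m p s)"
    using p symbol_lower_bound_imp_globally_hypoelliptic globally_hypoelliptic_imp_symbol_lower_bound by blast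
  ultimately show ?thesis by simp
qed

end
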